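(* Let $G$ be a finite simple connected graph. The following statements are equivalent: (1) $G$ has no anti-Kekul\'{e} set; (2) each connected spanning subgraph of $G$ has a perfect matching; (3) each spanning tree of $G$ has a perfect matching; (4) $G\in\mathcal{G}$.
   Context: All graphs are finite and simple. For a connected graph $G$, an edge subset $S\subseteq E(G)$ is an anti-Kekul\'{e} set of $G$ if $G-S$ is connected and has no perfect matching. The family $\mathcal{G}$ of graphs is defined recursively: (i) $K_2$ and all cycles of even length belong to $\mathcal{G}$; (ii) if $H$ is a connected graph of order $p\geq 2$ with vertex set $\{u_1,\ldots,u_p\}$, and $F_1,\ldots,F_p\in\mathcal{G}$, where $H,F_1,\ldots,F_p$ are pairwise vertex-disjoint, and for each $i$ a vertex $v_i\in V(F_i)$ is chosen, then the graph obtained from $H,F_1,\ldots,F_p$ by identifying $u_i$ with $v_i$ for each $i$ (denoted $H[F_1,\ldots,F_p]$) belongs to $\mathcal{G}$. Only graphs obtained by (i) and (ii) are in $\mathcal{G}$. *)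

theory Defs
  imports "Graph_Theory.Graph_Theory" "HOL-Library.Disjoint_Sets"
begin

text \<open>
  A finite simple graph is a \<open>pair_graph\<close>: finite, loop-free, with a symmetric set of
  arcs. An undirected edge is the two-element set of the ends of a pair of opposite arcs.
  Note that \<open>Digraph_Component.connected\<close> requires at least one vertex.
\<close>

definition edges :: "'a pair_pre_digraph \<Rightarrow> 'a set set" where
  "edges G = {{u, v} | u v. (u, v) \<in> parcs G}"

definition delete_edges :: "'a pair_pre_digraph \<Rightarrow> 'a set set \<Rightarrow> 'a pair_pre_digraph" where
  "delete_edges G S = \<lparr>pverts = pverts G, parcs = {(u, v) \<in> parcs G. {u, v} \<notin> S}\<rparr>"

definition perfect_matching :: "'a pair_pre_digraph \<Rightarrow> 'a set set \<Rightarrow> bool" where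
  "perfect_matching G M \<longleftrightarrow> M \<subseteq> edges G \<and> disjoint M \<and> \<Union>M = pverts G"

definition has_perfect_matching :: "'a pair_pre_digraph \<Rightarrow> bool" where
  "has_perfect_matching G \<longleftrightarrow> (\<exists>M. perfect_matching G M)"

definition anti_kekule_set :: "'a pair_pre_digraph \<Rightarrow> 'a set set \<Rightarrow> bool" where
  "anti_kekule_set G S \<longleftrightarrow> S \<subseteq> edges G
     \<and> Digraph_Component.connected (delete_edges G S)
     \<and> \<not> has_perfect_matching (delete_edges G S)"

definition connected_spanning_subgraph ::
    "'a pair_pre_digraph \<Rightarrow> 'a pair_pre_digraph \<Rightarrow> bool" where
  "connected_spanning_subgraph H G \<longleftrightarrow>
     pair_graph H \<and> spanning H G \<and> Digraph_Component.connected H"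

text \<open>
  The notions \<open>forest\<close> and \<open>tree\<close> of the session \<open>Graph_Theory\<close> concern directed cycles,
  which include the closed walk \<open>u, v, u\<close> along a pair of opposite arcs. In a
  \<open>pair_graph\<close> the undirected cycles are exactly the directed cycles of length at
  least 3.
\<close>

definition undirected_tree :: "'a pair_pre_digraph \<Rightarrow> bool" where
  "undirected_tree T \<longleftrightarrow> pair_graph T \<and> Digraph_Component.connected T
     \<and> \<not> (\<exists>p. pre_digraph.cycle T p \<and> 3 \<le> length p)"

definition undirected_spanning_tree ::
    "'a pair_pre_digraph \<Rightarrow> 'a pair_pre_digraph \<Rightarrow> bool" where
  "undirected_spanning_tree T G \<longleftrightarrow> undirected_tree T \<and> spanning T G"

definition cycle_graph :: "'a list \<Rightarrow> 'a pair_pre_digraph" where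
  "cycle_graph xs = \<lparr>pverts = set xs,
     parcs = symcl {(xs ! i, xs ! (Suc i mod length xs)) | i. i < length xs}\<rparr>"

text \<open>
  \<open>identify_graph H F v\<close> is the graph \<open>H[F\<^sub>1, \<dots>, F\<^sub>p]\<close>, the graphs \<open>F u\<close> and the vertices
  \<open>v u\<close> being indexed by the vertices \<open>u\<close> of \<open>H\<close>. The vertex that arises by identifying
  \<open>u\<close> with \<open>v u\<close> is named \<open>v u\<close>. The names of the vertices of \<open>H\<close> thus do not occur in
  the result, and disjointness of \<open>H\<close> from the graphs \<open>F u\<close>, which could always be
  arranged by renaming \<open>H\<close>, need not be required (a finite type \<open>'a\<close> might lack room for it).
\<close>

definition identify_graph ::
    "'a pair_pre_digraph \<Rightarrow> ('a \<Rightarrow> 'a pair_pre_digraph) \<Rightarrow> ('a \<Rightarrow> 'a) \<Rightarrow> 'a pair_pre_digraph" where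
  "identify_graph H F v = \<lparr>pverts = (\<Union>u\<in>pverts H. pverts (F u)),
     parcs = (\<Union>u\<in>pverts H. parcs (F u)) \<union> {(v u, v w) | u w. (u, w) \<in> parcs H}\<rparr>"

inductive_set family_G :: "'a pair_pre_digraph set" where
  K2: "complete_digraph 2 (with_proj G) \<Longrightarrow> G \<in> family_G"
| even_cycle: "distinct xs \<Longrightarrow> 3 \<le> length xs \<Longrightarrow> even (length xs) \<Longrightarrow> cycle_graph xs \<in> family_G"
| identify: "pair_graph H \<Longrightarrow> Digraph_Component.connected H \<Longrightarrow> 2 \<le> card (pverts H) \<Longrightarrow>
    (\<And>u. u \<in> pverts H \<Longrightarrow> F u \<in> family_G) \<Longrightarrow>
    disjoint_family_on (\<lambda>u. pverts (F u)) (pverts H) \<Longrightarrow>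
    (\<And>u. u \<in> pverts H \<Longrightarrow> v u \<in> pverts (F u)) \<Longrightarrow>
    identify_graph H F v \<in> family_G"

end

theory Submission
  imports Defs
begin

text \<open>
  The heart of the matter is that a graph all of whose connected spanning subgraphs have perfect
  matchings lies in the family. Suppose such a graph has a cut vertex \<open>c\<close>, and let \<open>U\<close> be
  a union of components of \<open>G - c\<close> of even total order. The vertices of \<open>U\<close> fall into the maximal
  parts that a single vertex separates from \<open>c\<close>; together with the complement of \<open>U\<close> these
  give a decomposition \<open>G = H[F\<^sub>1, \<dots>, F\<^sub>p]\<close>. If some part were odd, a spanning subgraph in which
  it hangs on a single edge of \<open>H\<close> would show that the neighbouring part is odd as well; as \<open>H\<close> is
  connected and the part at \<open>c\<close> is even, all parts are even, so they inherit the hypothesis.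
  Without a cut vertex, three neighbours of a vertex \<open>x\<close> would give a spanning subgraph in which
  two odd parts hang on \<open>x\<close>, which is impossible. Hence, unless \<open>G = K\<^sub>2\<close>, every vertex has
  degree two and \<open>G\<close> is an even cycle.
\<close>

section \<open>Connectivity and matchings of symmetric relations\<close>

text \<open>Connectedness is phrased through cuts instead of walks, which turns proofs about
  spanning subgraphs into closure arguments. For symmetric \<open>R\<close> it is connectedness of
  the graph induced on \<open>V\<close>; arcs leaving \<open>V\<close> are ignored, so one relation
  serves for many vertex sets.\<close>

definition cut_connected :: "'a set \<Rightarrow> 'a rel \<Rightarrow> bool" where
  "cut_connected V R \<longleftrightarrow> V \<noteq> {} \<and>
     (\<forall>S\<subseteq>V. S \<noteq> {} \<longrightarrow> S \<noteq> V \<longrightarrow> (\<exists>x\<in>S. \<exists>y\<in>V - S. (x, y) \<in> R))"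

lemma cut_connectedD:
  assumes "cut_connected V R" "S \<subseteq> V" "x \<in> S"
    and "\<And>a b. a \<in> S \<Longrightarrow> b \<in> V \<Longrightarrow> (a, b) \<in> R \<Longrightarrow> b \<in> S"
  shows "S = V"
  using assms unfolding cut_connected_def by blast

text \<open>For symmetric \<open>R\<close> the complement of a closed set is closed too, and one of
  the two contains \<open>r\<close>; so only closed sets through \<open>r\<close> have to be
  examined.\<close>

lemma cut_connected_rootI:
  assumes "sym R" "r \<in> V"
    and closed: "\<And>S. S \<subseteq> V \<Longrightarrow> r \<in> S \<Longrightarrow>
      (\<And>a b. a \<in> S \<Longrightarrow> b \<in> V \<Longrightarrow> (a, b) \<in> R \<Longrightarrow> b \<in> S) \<Longrightarrow> S = V"
  shows "cut_connected V R"
  unfolding cut_connected_def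
proof (intro conjI allI impI)
  show "V \<noteq> {}" using assms by blast
  fix S assume S: "S \<subseteq> V" "S \<noteq> {}" "S \<noteq> V"
  show "\<exists>x\<in>S. \<exists>y\<in>V - S. (x, y) \<in> R"
  proof (rule ccontr)
    assume no: "\<not> ?thesis"
    show False
    proof (cases "r \<in> S")
      case True
      then show False using closed[of S] S no by blast
    next
      case False
      have "V - S = V"
        by (rule closed) (use no False \<open>sym R\<close> \<open>r \<in> V\<close> in \<open>auto dest: symD\<close>)
      then show False using S by blast
    qed
  qed
qed

lemma cut_connected_mono: "cut_connected V R \<Longrightarrow> R \<inter> V \<times> V \<subseteq> R' \<Longrightarrow> cut_connected V R'"
  unfolding cut_connected_def by blast

lemma cut_connected_Un:
  assumes "cut_connected A R" "cut_connected B R" "sym R"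
    and "x \<in> A" "y \<in> B" "x = y \<or> (x, y) \<in> R"
  shows "cut_connected (A \<union> B) R"
proof (rule cut_connected_rootI[of _ x])
  fix S assume S: "S \<subseteq> A \<union> B" "x \<in> S"
    "\<And>a b. a \<in> S \<Longrightarrow> b \<in> A \<union> B \<Longrightarrow> (a, b) \<in> R \<Longrightarrow> b \<in> S"
  have "S \<inter> A = A" by (rule cut_connectedD[OF assms(1)]) (use S assms in auto)
  moreover have "y \<in> S" using S assms by blast
  moreover have "S \<inter> B = B"
    by (rule cut_connectedD[OF assms(2), of _ y]) (use S assms \<open>y \<in> S\<close> in auto)
  ultimately show "S = A \<union> B" using S by blast
qed (use assms in auto)

lemma cut_connected_iff_rtrancl:
  "cut_connected V R \<longleftrightarrow> V \<noteq> {} \<and> (\<forall>x\<in>V. \<forall>y\<in>V. (x, y) \<in> (R \<inter> V \<times> V)\<^sup>*)" (is "?L \<longleftrightarrow> ?R")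
proof
  assume L: ?L
  show ?R
  proof (intro conjI ballI)
    show "V \<noteq> {}" using L unfolding cut_connected_def by blast
    fix x y assume xy: "x \<in> V" "y \<in> V"
    have "{z \<in> V. (x, z) \<in> (R \<inter> V \<times> V)\<^sup>*} = V"
      by (rule cut_connectedD[OF L, of _ x]) (auto simp: xy intro: rtrancl_into_rtrancl)
    then show "(x, y) \<in> (R \<inter> V \<times> V)\<^sup>*" using xy by blast
  qed
next
  assume R: ?R
  show ?L
    unfolding cut_connected_def
  proof (intro conjI allI impI)
    show "V \<noteq> {}" using R by blast
    fix S assume S: "S \<subseteq> V" "S \<noteq> {}" "S \<noteq> V"
    then obtain x y where xy: "x \<in> S" "y \<in> V" "y \<notin> S" by blast
    then have "(x, y) \<in> (R \<inter> V \<times> V)\<^sup>*" using R S by blast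
    then show "\<exists>x\<in>S. \<exists>y\<in>V - S. (x, y) \<in> R"
      using xy by (induction rule: rtrancl_induct) auto
  qed
qed

lemma cut_connected_outgoing:
  assumes "cut_connected V R" "S \<subseteq> V" "S \<noteq> {}" "S \<noteq> V"
  obtains x y where "x \<in> S" "y \<in> V - S" "(x, y) \<in> R"
  using assms unfolding cut_connected_def by blast

text \<open>The component of \<open>r\<close> in the graph induced on \<open>U\<close>. For
  \<open>r\<close> outside \<open>U\<close> the reflexive closure still yields \<open>{r}\<close>,
  which is why several later facts ask for \<open>r \<in> U\<close>.\<close>

definition reach :: "'a rel \<Rightarrow> 'a set \<Rightarrow> 'a \<Rightarrow> 'a set" where
  "reach R U r = {z. (r, z) \<in> (R \<inter> U \<times> U)\<^sup>*}"

lemma reach_root: "r \<in> reach R U r"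
  by (simp add: reach_def)

lemma reach_subset: "r \<in> U \<Longrightarrow> reach R U r \<subseteq> U"
  unfolding reach_def by (auto elim: rtranclE)

lemma reach_step: "a \<in> reach R U r \<Longrightarrow> r \<in> U \<Longrightarrow> b \<in> U \<Longrightarrow> (a, b) \<in> R \<Longrightarrow> b \<in> reach R U r"
  using reach_subset[of r U R] unfolding reach_def by (blast intro: rtrancl_into_rtrancl)

lemma reach_least:
  assumes "r \<in> S" "\<And>a b. a \<in> S \<Longrightarrow> b \<in> U \<Longrightarrow> (a, b) \<in> R \<Longrightarrow> b \<in> S"
  shows "reach R U r \<subseteq> S"
proof
  fix z assume "z \<in> reach R U r"
  then have "(r, z) \<in> (R \<inter> U \<times> U)\<^sup>*" by (simp add: reach_def)
  then show "z \<in> S" by (induction rule: rtrancl_induct) (use assms in auto)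
qed

lemma reach_connected:
  assumes "sym R" "r \<in> U"
  shows "cut_connected (reach R U r) R"
proof (rule cut_connected_rootI[of _ r])
  fix S assume S: "S \<subseteq> reach R U r" "r \<in> S"
    "\<And>a b. a \<in> S \<Longrightarrow> b \<in> reach R U r \<Longrightarrow> (a, b) \<in> R \<Longrightarrow> b \<in> S"
  have "reach R U r \<subseteq> S"
    by (rule reach_least) (use S assms in \<open>auto intro: reach_step\<close>)
  then show "S = reach R U r" using S by blast
qed (use assms reach_root in auto)

text \<open>A perfect matching is encoded as the map to the partner, a fixed-point-free involution.
  Parity arguments then reduce to finding a subset that the map preserves.\<close>

definition involutive_matching :: "'a set \<Rightarrow> 'a rel \<Rightarrow> ('a \<Rightarrow> 'a) \<Rightarrow> bool" where
  "involutive_matching V R f \<longleftrightarrow>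
     (\<forall>x\<in>V. f x \<in> V \<and> f x \<noteq> x \<and> (x, f x) \<in> R \<and> f (f x) = x)"

definition matchable :: "'a set \<Rightarrow> 'a rel \<Rightarrow> bool" where
  "matchable V R \<longleftrightarrow> (\<exists>f. involutive_matching V R f)"

text \<open>Induction by removing an orbit \<open>{x, f x}\<close>, which leaves an invariant
  set.\<close>

lemma even_card_involution:
  assumes "finite S" "\<And>x. x \<in> S \<Longrightarrow> f x \<in> S \<and> f x \<noteq> x \<and> f (f x) = x"
  shows "even (card S)"
  using assms
proof (induction rule: finite_psubset_induct)
  case (psubset S)
  show ?case
  proof (cases "S = {}")
    case False
    then obtain x where x: "x \<in> S" by blast
    let ?T = "S - {x, f x}"
    have fx: "f x \<in> S" "f x \<noteq> x" "f (f x) = x" using psubset.prems x by auto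
    have "even (card ?T)"
    proof (rule psubset.IH)
      fix y assume y: "y \<in> ?T"
      then have "f y \<in> S" "f y \<noteq> y" "f (f y) = y" using psubset.prems by auto
      then show "f y \<in> ?T \<and> f y \<noteq> y \<and> f (f y) = y" using y fx by auto
    qed (use x in auto)
    moreover have "card S = card ?T + 2"
    proof -
      have "S = insert x (insert (f x) ?T)" using x fx by blast
      then have "card S = card (insert x (insert (f x) ?T))" by simp
      also have "\<dots> = card ?T + 2" using psubset.hyps fx by simp
      finally show ?thesis .
    qed
    ultimately show ?thesis by simp
  qed simp
qed

lemma matchable_even: "finite V \<Longrightarrow> matchable V R \<Longrightarrow> even (card V)"
  unfolding matchable_def involutive_matching_def using even_card_involution by metis

lemma matchable_UN:
  assumes "disjoint_family_on A I" "\<And>i. i \<in> I \<Longrightarrow> matchable (A i) R"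
  shows "matchable (\<Union>i\<in>I. A i) R"
proof -
  obtain f where f: "\<And>i. i \<in> I \<Longrightarrow> involutive_matching (A i) R (f i)"
    using assms(2) unfolding matchable_def by metis
  define j where "j x = (THE i. i \<in> I \<and> x \<in> A i)" for x
  have j: "j x = i" if "i \<in> I" "x \<in> A i" for i x
    unfolding j_def using that assms(1) by (auto simp: disjoint_family_on_def intro!: the_equality)
  have "involutive_matching (\<Union>i\<in>I. A i) R (\<lambda>x. f (j x) x)"
    unfolding involutive_matching_def
  proof
    fix x assume "x \<in> (\<Union>i\<in>I. A i)"
    then obtain i where i: "i \<in> I" "x \<in> A i" by blast
    then have "f i x \<in> A i" "f i x \<noteq> x" "(x, f i x) \<in> R" "f i (f i x) = x"
      using f unfolding involutive_matching_def by auto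
    then show "f (j x) x \<in> (\<Union>i\<in>I. A i) \<and> f (j x) x \<noteq> x \<and> (x, f (j x) x) \<in> R
        \<and> f (j (f (j x) x)) (f (j x) x) = x"
      using i j by auto
  qed
  then show ?thesis unfolding matchable_def by blast
qed

lemma matchable_mono: "matchable V R \<Longrightarrow> R \<subseteq> R' \<Longrightarrow> matchable V R'"
  unfolding matchable_def involutive_matching_def by blast

text \<open>The relational form of the condition that every connected spanning subgraph has a
  perfect matching; all the equivalences pass through it.\<close>

definition robustly_matchable :: "'a set \<Rightarrow> 'a rel \<Rightarrow> bool" where
  "robustly_matchable V R \<longleftrightarrow>
     (\<forall>R'\<subseteq>R. sym R' \<longrightarrow> cut_connected V R' \<longrightarrow> matchable V R')"

lemma robustly_matchableD:
  assumes "robustly_matchable V R" "R' \<subseteq> R" "sym R'" "cut_connected V R'"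
  obtains f where "involutive_matching V R' f"
  using assms unfolding robustly_matchable_def matchable_def by blast

section \<open>Translation to pair graphs\<close>

lemma pair_graph_iff:
  "pair_graph G \<longleftrightarrow> finite (pverts G) \<and> parcs G \<subseteq> pverts G \<times> pverts G
     \<and> sym (parcs G) \<and> irrefl (parcs G)" (is "?L \<longleftrightarrow> ?R")
proof
  assume ?L
  then interpret pair_graph G .
  show ?R
    using pair_finite_verts pair_sym_arcs
    by (auto simp: irrefl_def symmetric_def dest: in_arcsD1 in_arcsD2 no_loops')
next
  assume R: ?R
  then have "finite (parcs G)" by (meson finite_SigmaI finite_subset)
  with R show ?L
    by unfold_locales (auto simp: irrefl_def symmetric_def)
qed

lemma connected_iff_cut_connected:
  assumes "sym (parcs G)" "parcs G \<subseteq> pverts G \<times> pverts G"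
  shows "Digraph_Component.connected (with_proj G) \<longleftrightarrow> cut_connected (pverts G) (parcs G)"
proof -
  interpret pair_wf_digraph G by unfold_locales (use assms in auto)
  have "(parcs G)\<^sup>s = parcs G" using assms by (auto simp: symcl_def dest: symD)
  moreover have "parcs G \<inter> pverts G \<times> pverts G = parcs G" using assms by blast
  moreover have "(u, v) \<in> rtrancl_on (pverts G) (parcs G) \<longleftrightarrow> (u, v) \<in> (parcs G)\<^sup>*"
    if "u \<in> pverts G" for u v
    using reachable_conv'[of u v] that by (simp add: reachable_def)
  ultimately show ?thesis
    unfolding connected_conv cut_connected_iff_rtrancl by simp
qed

text \<open>Disjointness makes the partner of a vertex in \<open>M\<close> unique, which yields the
  involution; conversely the orbits \<open>{x, f x}\<close> form a matching.\<close>

lemma has_perfect_matching_iff: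
  assumes "pair_graph G"
  shows "has_perfect_matching G \<longleftrightarrow> matchable (pverts G) (parcs G)"
proof
  have G: "parcs G \<subseteq> pverts G \<times> pverts G" "sym (parcs G)" "irrefl (parcs G)"
    using assms by (auto simp: pair_graph_iff)
  {
    assume "has_perfect_matching G"
    then obtain M where M: "M \<subseteq> edges G" "disjoint M" "\<Union>M = pverts G"
      unfolding has_perfect_matching_def perfect_matching_def by blast
    have ex: "\<exists>y. {x, y} \<in> M \<and> (x, y) \<in> parcs G" if x: "x \<in> pverts G" for x
    proof -
      obtain m where m: "m \<in> M" "x \<in> m" using M(3) x by blast
      then obtain u v where uv: "m = {u, v}" "(u, v) \<in> parcs G"
        using M(1) unfolding edges_def by blast
      then have "(v, u) \<in> parcs G" "m = {v, u}" using G(2) by (auto dest: symD)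
      moreover have "x = u \<or> x = v" using m uv by blast
      ultimately show ?thesis using m uv by metis
    qed
    have eq: "y = z" if "{x, y} \<in> M" "{x, z} \<in> M" for x y z
    proof -
      have "{x, y} = {x, z}" using disjointD[OF M(2) that] by blast
      then show ?thesis by (auto simp: doubleton_eq_iff)
    qed
    obtain f where f: "\<And>x. x \<in> pverts G \<Longrightarrow> {x, f x} \<in> M \<and> (x, f x) \<in> parcs G"
      using ex by metis
    have "involutive_matching (pverts G) (parcs G) f"
      unfolding involutive_matching_def
    proof
      fix x assume x: "x \<in> pverts G"
      then have fx: "f x \<in> pverts G" using f G(1) by blast
      have "f (f x) = x" using f[OF x] f[OF fx] eq by (metis insert_commute)
      then show "f x \<in> pverts G \<and> f x \<noteq> x \<and> (x, f x) \<in> parcs G \<and> f (f x) = x"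
        using fx f[OF x] G(3) by (metis irrefl_def)
    qed
    then show "matchable (pverts G) (parcs G)" unfolding matchable_def by blast
  }
  {
    assume "matchable (pverts G) (parcs G)"
    then obtain f where f: "involutive_matching (pverts G) (parcs G) f"
      unfolding matchable_def by blast
    have "perfect_matching G ((\<lambda>x. {x, f x}) ` pverts G)"
      unfolding perfect_matching_def
    proof (intro conjI)
      show "(\<lambda>x. {x, f x}) ` pverts G \<subseteq> edges G"
        using f unfolding edges_def involutive_matching_def by blast
      have block: "{x, f x} = {z, f z}" if "x \<in> pverts G" "z \<in> {x, f x}" for x z
      proof -
        have "f (f x) = x" using f that(1) unfolding involutive_matching_def by blast
        then show ?thesis using that(2) by (elim insertE) (simp_all add: insert_commute)
      qed
      show "disjoint ((\<lambda>x. {x, f x}) ` pverts G)"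
      proof (rule disjointI)
        fix a b assume ab: "a \<in> (\<lambda>x. {x, f x}) ` pverts G" "b \<in> (\<lambda>x. {x, f x}) ` pverts G" "a \<noteq> b"
        then obtain x y where "x \<in> pverts G" "a = {x, f x}" "y \<in> pverts G" "b = {y, f y}" by blast
        then show "a \<inter> b = {}" using ab(3) block by blast
      qed
      have "f x \<in> pverts G" if "x \<in> pverts G" for x
        using f that unfolding involutive_matching_def by blast
      then show "\<Union> ((\<lambda>x. {x, f x}) ` pverts G) = pverts G" by blast
    qed
    then show "has_perfect_matching G" unfolding has_perfect_matching_def by blast
  }
qed

lemma connected_spanning_subgraph_iff:
  assumes "pair_graph G"
  shows "connected_spanning_subgraph H G \<longleftrightarrow> pverts H = pverts G \<and> parcs H \<subseteq> parcs G
     \<and> sym (parcs H) \<and> cut_connected (pverts H) (parcs H)" (is "?L \<longleftrightarrow> ?R")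
proof
  assume ?L
  then have "pair_graph H" "spanning H G" "Digraph_Component.connected H"
    by (auto simp: connected_spanning_subgraph_def)
  then show ?R
    using connected_iff_cut_connected[of H]
    by (auto simp: spanning_def subgraph_def pair_graph_iff)
next
  assume R: ?R
  then have "pair_graph H"
    using assms by (auto simp: pair_graph_iff irrefl_def)
  moreover have "wf_digraph (with_proj G)" "wf_digraph (with_proj H)"
    using assms calculation by (auto simp: wf_digraph_wp_iff pair_wf_digraph_def pair_graph_iff)
  ultimately show ?L
    using R connected_iff_cut_connected[of H]
    by (auto simp: connected_spanning_subgraph_def spanning_def subgraph_def pair_graph_iff)
qed

lemma all_connected_spanning_subgraphs_iff:
  assumes "pair_graph G"
  shows "(\<forall>H. connected_spanning_subgraph H G \<longrightarrow> has_perfect_matching H)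
     \<longleftrightarrow> robustly_matchable (pverts G) (parcs G)" (is "?L \<longleftrightarrow> ?R")
proof
  assume L: ?L
  show ?R
    unfolding robustly_matchable_def
  proof (intro allI impI)
    fix R assume R: "R \<subseteq> parcs G" "sym R" "cut_connected (pverts G) R"
    let ?H = "\<lparr>pverts = pverts G, parcs = R\<rparr>"
    have "connected_spanning_subgraph ?H G"
      using R assms by (simp add: connected_spanning_subgraph_iff)
    then show "matchable (pverts G) R"
      using L has_perfect_matching_iff[of ?H] by (auto simp: connected_spanning_subgraph_def)
  qed
next
  assume R: ?R
  show ?L
  proof (intro allI impI)
    fix H assume H: "connected_spanning_subgraph H G"
    then show "has_perfect_matching H"
      using R assms has_perfect_matching_iff[of H] connected_spanning_subgraph_iff[of G H]
      unfolding robustly_matchable_def connected_spanning_subgraph_def by auto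
  qed
qed

text \<open>Deleting edge sets yields exactly the spanning subgraphs: \<open>H\<close> is recovered
  from \<open>G\<close> by deleting \<open>edges G - edges H\<close>.\<close>

lemma no_anti_kekule_set_iff:
  assumes "pair_graph G"
  shows "(\<nexists>S. anti_kekule_set G S) \<longleftrightarrow>
     (\<forall>H. connected_spanning_subgraph H G \<longrightarrow> has_perfect_matching H)" (is "?L \<longleftrightarrow> ?R")
proof
  have G: "parcs G \<subseteq> pverts G \<times> pverts G" "sym (parcs G)" "irrefl (parcs G)"
    using assms by (auto simp: pair_graph_iff)
  {
    assume L: ?L
    show ?R
    proof (intro allI impI)
      fix H assume H: "connected_spanning_subgraph H G"
      then have *: "pverts H = pverts G" "parcs H \<subseteq> parcs G" "sym (parcs H)"
        using connected_spanning_subgraph_iff[OF assms] by auto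
      have eq: "delete_edges G (edges G - edges H) = H"
      proof (rule pair_pre_digraph.equality)
        show "parcs (delete_edges G (edges G - edges H)) = parcs H"
          using * by (auto simp: delete_edges_def edges_def doubleton_eq_iff dest: symD)
      qed (use * in \<open>auto simp: delete_edges_def\<close>)
      have "\<not> anti_kekule_set G (edges G - edges H)" using L by blast
      then show "has_perfect_matching H"
        using H unfolding anti_kekule_set_def eq by (auto simp: connected_spanning_subgraph_def)
    qed
  }
  {
    assume R: ?R
    show ?L
    proof
      assume "\<exists>S. anti_kekule_set G S"
      then obtain S where S: "Digraph_Component.connected (delete_edges G S)"
        "\<not> has_perfect_matching (delete_edges G S)"
        unfolding anti_kekule_set_def by blast
      have arcs: "parcs (delete_edges G S) \<subseteq> parcs G" "sym (parcs (delete_edges G S))"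
        using G by (auto simp: delete_edges_def sym_def insert_commute)
      moreover have "pverts (delete_edges G S) = pverts G" by (simp add: delete_edges_def)
      moreover have "cut_connected (pverts (delete_edges G S)) (parcs (delete_edges G S))"
        using S(1) connected_iff_cut_connected[of "delete_edges G S"] calculation G by auto
      ultimately have "connected_spanning_subgraph (delete_edges G S) G"
        using connected_spanning_subgraph_iff[OF assms] by blast
      then show False using R S by blast
    qed
  }
qed

section \<open>Spanning trees\<close>

lemma pcas_rtrancl:
  "pcas u p v \<Longrightarrow> set p \<subseteq> R \<Longrightarrow> (u, v) \<in> R\<^sup>*"
  by (induction p arbitrary: u) (auto intro: converse_rtrancl_into_rtrancl)

lemma fst_mem_pawalk_verts: "e \<in> set p \<Longrightarrow> fst e \<in> set (pawalk_verts w p)"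
  by (induction p arbitrary: w) auto

lemma pcas_last_mem: "pcas w p u \<Longrightarrow> u \<in> set (pawalk_verts w p)"
  by (induction p arbitrary: w) auto

text \<open>The end \<open>u\<close> is visited only once, so no arc of the walk can start
  there.\<close>

lemma pcas_no_arc_from_end:
  assumes "pcas w p u" "distinct (pawalk_verts w p)"
  shows "(u, y) \<notin> set p"
  using assms by (induction p arbitrary: w) (auto dest: pcas_last_mem)

text \<open>The rest of the cycle is a detour around its first arc \<open>(u, w)\<close>. Length at
  least 3 keeps the detour from using the reversed arc, so the whole edge may be deleted without
  disconnecting its ends.\<close>

lemma cycle_bypass:
  assumes cyc: "pre_digraph.cycle (with_proj T) p" "3 \<le> length p"
  obtains u w where "(u, w) \<in> parcs T" "(w, u) \<in> (parcs T - {(u, w), (w, u)})\<^sup>*"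
proof -
  interpret pair_pre_digraph T .
  obtain u where u: "awalk u p u" "distinct (tl (pawalk_verts u p))"
    using cyc unfolding cycle_def by auto
  obtain e q where p: "p = e # q" using cyc by (cases p) auto
  define w where "w = snd e"
  have e: "e = (u, w)" and arcs: "(u, w) \<in> parcs T" "set q \<subseteq> parcs T" and q: "pcas w q u"
    and dist: "distinct (pawalk_verts w q)"
    using u p by (auto simp: awalk_def w_def)
  have "(u, w) \<notin> set q" using pcas_no_arc_from_end[OF q dist] .
  moreover have "(w, u) \<notin> set q"
  proof
    \<comment> \<open>As \<open>w\<close> is not revisited, \<open>(w, u)\<close> would be the first
      arc of \<open>q\<close>. The walk has then arrived at its end \<open>u\<close>, yet its
      remaining arcs are nonempty and leave \<open>u\<close>.\<close>
    assume wu: "(w, u) \<in> set q"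
    obtain e' q' where q': "q = e' # q'" "q' \<noteq> []"
      using cyc p by (cases q; cases "tl q") auto
    have "fst e' = w" "pcas (snd e') q' u" "w \<notin> set (pawalk_verts (snd e') q')"
      "distinct (pawalk_verts (snd e') q')"
      using q dist q' by auto
    moreover from this have "(w, u) \<notin> set q'" using fst_mem_pawalk_verts by fastforce
    ultimately have "snd e' = u" using wu q' by (metis set_ConsD snd_conv)
    then have "hd q' = (u, snd (hd q'))" "hd q' \<in> set q'"
      using \<open>pcas (snd e') q' u\<close> \<open>q' \<noteq> []\<close> by (cases q'; auto)+
    then show False
      using pcas_no_arc_from_end[OF \<open>pcas (snd e') q' u\<close> \<open>distinct (pawalk_verts (snd e') q')\<close>]
      by metis
  qed
  ultimately have "set q \<subseteq> parcs T - {(u, w), (w, u)}" using arcs by blast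
  then have "(w, u) \<in> (parcs T - {(u, w), (w, u)})\<^sup>*" using pcas_rtrancl[OF q] by blast
  then show ?thesis using that arcs by blast
qed

lemma cut_connected_remove_edge:
  assumes "cut_connected V R" "sym R" "R \<subseteq> V \<times> V"
    and bypass: "(w, u) \<in> (R - {(u, w), (w, u)})\<^sup>*"
  shows "cut_connected V (R - {(u, w), (w, u)})"
proof -
  let ?R = "R - {(u, w), (w, u)}"
  have symR: "sym ?R" using assms(2) by (auto simp: sym_def)
  then have "(u, w) \<in> ?R\<^sup>*" using bypass by (meson sym_rtrancl symD)
  then have "R \<subseteq> ?R\<^sup>*" using bypass by auto
  then have "R\<^sup>* \<subseteq> ?R\<^sup>*" by (rule rtrancl_subset_rtrancl)
  moreover have R: "R \<inter> V \<times> V = R" "?R \<inter> V \<times> V = ?R" using assms(3) by auto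
  ultimately show ?thesis
    using assms(1) unfolding cut_connected_iff_rtrancl R by blast
qed

text \<open>A connected spanning subgraph of \<open>G\<close> inside \<open>H\<close> with fewest
  arcs is a tree, for an edge on a cycle could be removed.\<close>

lemma spanning_tree_exists:
  assumes "pair_graph G" "connected_spanning_subgraph H G"
  obtains T where "undirected_spanning_tree T G" "pverts T = pverts H" "parcs T \<subseteq> parcs H"
proof -
  note css = connected_spanning_subgraph_iff[OF assms(1)]
  define Q where "Q T \<longleftrightarrow> connected_spanning_subgraph T G \<and> parcs T \<subseteq> parcs H" for T
  obtain T where T: "Q T" and min: "\<And>T'. Q T' \<Longrightarrow> card (parcs T) \<le> card (parcs T')"
    using ex_has_least_nat[of Q H "\<lambda>T. card (parcs T)"] assms(2) unfolding Q_def by blast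
  have G: "finite (pverts G)" "parcs G \<subseteq> pverts G \<times> pverts G"
    using assms(1) by (auto simp: pair_graph_iff)
  have T': "pverts T = pverts G" "parcs T \<subseteq> parcs G" "sym (parcs T)"
    "cut_connected (pverts T) (parcs T)" "parcs T \<subseteq> parcs H"
    using T unfolding Q_def css by auto
  have fin: "finite (parcs T)" using T' G by (meson finite_SigmaI finite_subset)
  have "\<not> (\<exists>p. pre_digraph.cycle T p \<and> 3 \<le> length p)"
  proof
    assume "\<exists>p. pre_digraph.cycle T p \<and> 3 \<le> length p"
    then obtain u w where uw: "(u, w) \<in> parcs T" "(w, u) \<in> (parcs T - {(u, w), (w, u)})\<^sup>*"
      using cycle_bypass by metis
    let ?T = "\<lparr>pverts = pverts T, parcs = parcs T - {(u, w), (w, u)}\<rparr>"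
    have "cut_connected (pverts T) (parcs T - {(u, w), (w, u)})"
      by (rule cut_connected_remove_edge) (use T' G uw in auto)
    moreover have "sym (parcs T - {(u, w), (w, u)})" using T'(3) by (auto simp: sym_def)
    ultimately have "Q ?T" using T' unfolding Q_def css by auto
    then have "card (parcs T) \<le> card (parcs T - {(u, w), (w, u)})" using min by fastforce
    moreover have "card (parcs T - {(u, w), (w, u)}) < card (parcs T)"
      by (rule psubset_card_mono) (use fin uw in auto)
    ultimately show False by simp
  qed
  then have "undirected_spanning_tree T G"
    using T unfolding Q_def connected_spanning_subgraph_def undirected_spanning_tree_def
      undirected_tree_def by auto
  moreover have "pverts T = pverts H" using T' assms(2) unfolding css by simp
  ultimately show ?thesis using that T' by blast
qed

text \<open>Only the step from trees to subgraphs has content: a perfect matching of a spanning tree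
  inside \<open>H\<close> is one of \<open>H\<close>.\<close>

lemma all_spanning_trees_iff:
  assumes "pair_graph G"
  shows "(\<forall>T. undirected_spanning_tree T G \<longrightarrow> has_perfect_matching T) \<longleftrightarrow>
     (\<forall>H. connected_spanning_subgraph H G \<longrightarrow> has_perfect_matching H)" (is "?L \<longleftrightarrow> ?R")
proof
  assume L: ?L
  show ?R
  proof (intro allI impI)
    fix H assume H: "connected_spanning_subgraph H G"
    obtain T where T: "undirected_spanning_tree T G" "pverts T = pverts H" "parcs T \<subseteq> parcs H"
      using spanning_tree_exists[OF assms H] .
    then have "matchable (pverts T) (parcs T)"
      using L has_perfect_matching_iff[of T]
      unfolding undirected_spanning_tree_def undirected_tree_def by blast
    then have "matchable (pverts H) (parcs H)" using T matchable_mono by metis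
    then show "has_perfect_matching H"
      using H has_perfect_matching_iff[of H] unfolding connected_spanning_subgraph_def by blast
  qed
qed (auto simp: undirected_spanning_tree_def undirected_tree_def connected_spanning_subgraph_def)

section \<open>Graphs of the family are robustly matchable\<close>

lemma robustly_matchable_pair:
  assumes "u \<noteq> v"
  shows "robustly_matchable {u, v} R"
  unfolding robustly_matchable_def
proof (intro allI impI)
  fix R' assume R': "R' \<subseteq> R" "sym R'" "cut_connected {u, v} R'"
  have "(u, v) \<in> R'"
    by (rule cut_connected_outgoing[OF R'(3), of "{u}"]) (use assms in auto)
  then have "involutive_matching {u, v} R' (\<lambda>x. if x = u then v else u)"
    using assms R'(2) unfolding involutive_matching_def by (auto dest: symD)
  then show "matchable {u, v} R'" unfolding matchable_def by blast
qed

text \<open>Consecutive entries are paired off from the front. For an even cycle this gives one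
  perfect matching, and rotating the list by one gives the other.\<close>

lemma matchable_list_pairs:
  assumes "distinct ys" "even (length ys)" "sym R"
    and "\<And>j. Suc (2 * j) < length ys \<Longrightarrow> (ys ! (2 * j), ys ! Suc (2 * j)) \<in> R"
  shows "matchable (set ys) R"
  using assms
proof (induction ys rule: induct_list012)
  case 1
  show ?case by (simp add: matchable_def involutive_matching_def)
next
  case (2 x)
  then show ?case by simp
next
  case (3 x y zs)
  have "matchable (set zs) R"
  proof (rule 3)
    fix j assume "Suc (2 * j) < length zs"
    then show "(zs ! (2 * j), zs ! Suc (2 * j)) \<in> R" using 3(6)[of "Suc j"] by simp
  qed (use 3(3,4,5) in \<open>simp_all\<close>)
  then obtain f where f: "involutive_matching (set zs) R f" unfolding matchable_def by blast
  have "(x, y) \<in> R" using 3(6)[of 0] by simp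
  then have "involutive_matching (set (x # y # zs)) R (f(x := y, y := x))"
    using f 3 unfolding involutive_matching_def by (auto dest: symD)
  then show ?case unfolding matchable_def by blast
qed

lemma symcl_iff: "(x, y) \<in> R\<^sup>s \<longleftrightarrow> (x, y) \<in> R \<or> (y, x) \<in> R"
  unfolding symcl_def by force

lemma parcs_cycle_graph_iff:
  "(x, y) \<in> parcs (cycle_graph xs) \<longleftrightarrow>
     (\<exists>k<length xs. {x, y} = {xs ! k, xs ! (Suc k mod length xs)})"
proof -
  let ?C = "{(xs ! i, xs ! (Suc i mod length xs)) | i. i < length xs}"
  have "(x, y) \<in> parcs (cycle_graph xs) \<longleftrightarrow> (x, y) \<in> ?C \<or> (y, x) \<in> ?C"
    unfolding cycle_graph_def by (simp add: symcl_iff)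
  then show ?thesis unfolding doubleton_eq_iff by blast
qed

text \<open>The segment at positions \<open>i + 1\<close> to \<open>j\<close> can be left only along
  the edges numbered \<open>i\<close> and \<open>j\<close>, so a connected spanning subgraph keeps
  one of them. Since \<open>i < j\<close>, only the second edge may wrap around.\<close>

lemma cycle_missing_two_edges:
  assumes xs: "distinct xs" and R: "R \<subseteq> parcs (cycle_graph xs)"
    and conn: "cut_connected (set xs) R" and ij: "i < j" "j < length xs"
    and missing: "(xs ! i, xs ! Suc i) \<notin> R" "(xs ! Suc i, xs ! i) \<notin> R"
      "(xs ! j, xs ! (Suc j mod length xs)) \<notin> R" "(xs ! (Suc j mod length xs), xs ! j) \<notin> R"
  shows False
proof -
  let ?n = "length xs"
  define S where "S = {xs ! k | k. i < k \<and> k \<le> j}"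
  have mem: "xs ! k \<in> S \<longleftrightarrow> i < k \<and> k \<le> j" if "k < ?n" for k
    using that xs ij unfolding S_def by (auto simp: nth_eq_iff_index_eq)
  have "S \<noteq> {}" using ij unfolding S_def by blast
  moreover have "S \<subseteq> set xs" using ij unfolding S_def by auto
  moreover have "xs ! i \<in> set xs" "xs ! i \<notin> S" using mem[of i] ij by auto
  ultimately obtain x y where xy: "x \<in> S" "y \<in> set xs - S" "(x, y) \<in> R"
    using cut_connected_outgoing[OF conn, of S] by blast
  obtain k where k: "k < ?n" "{x, y} = {xs ! k, xs ! (Suc k mod ?n)}"
    using xy R by (meson parcs_cycle_graph_iff subsetD)
  show False
  proof (cases "Suc k = ?n")
    case True
    moreover have "0 < ?n" using ij by linarith
    then have "xs ! 0 \<notin> S" using mem[of 0] by simp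
    ultimately have *: "x = xs ! k" "y = xs ! 0" using xy k by (auto simp: doubleton_eq_iff)
    then have "k = j" using xy k mem[of k] True ij by auto
    then show False using * xy missing True by auto
  next
    case False
    then have "k = i \<or> k = j"
      using xy k mem[of k] mem[of "Suc k"] by (auto simp: doubleton_eq_iff)
    then show False using xy k missing False ij by (auto simp: doubleton_eq_iff)
  qed
qed

text \<open>At most one edge is missing, so all edges with even number are present or all those with
  odd number are; either set is a perfect matching.\<close>

lemma robustly_matchable_even_cycle:
  assumes xs: "distinct xs" "3 \<le> length xs" "even (length xs)"
  shows "robustly_matchable (set xs) (parcs (cycle_graph xs))"
  unfolding robustly_matchable_def
proof (intro allI impI)
  fix R assume R: "R \<subseteq> parcs (cycle_graph xs)" "sym R" "cut_connected (set xs) R"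
  let ?n = "length xs"
  let ?e = "\<lambda>i. (xs ! i, xs ! (Suc i mod ?n))"
  have one: "?e i \<in> R \<or> ?e j \<in> R" if "i < j" "j < ?n" for i j
    using cycle_missing_two_edges[OF xs(1) R(1,3) that] that R(2) by (auto dest: symD)
  show "matchable (set xs) R"
  proof (cases "\<forall>j. Suc (2 * j) < ?n \<longrightarrow> ?e (2 * j) \<in> R")
    case True
    show ?thesis
      by (rule matchable_list_pairs) (use xs R True in auto)
  next
    case False
    then obtain j where j: "Suc (2 * j) < ?n" "?e (2 * j) \<notin> R" by blast
    have odd: "?e (Suc (2 * k)) \<in> R" if "Suc (2 * k) < ?n" for k
    proof -
      have "2 * j \<noteq> Suc (2 * k)" by presburger
      then consider "2 * j < Suc (2 * k)" | "Suc (2 * k) < 2 * j" by linarith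
      then show ?thesis
        using one[of "2 * j" "Suc (2 * k)"] one[of "Suc (2 * k)" "2 * j"] that j by cases auto
    qed
    \<comment> \<open>The rotation moves the edges with odd number, including the one that closes
      the cycle, to the pairs of positions \<open>2 * k\<close> and
      \<open>2 * k + 1\<close>.\<close>
    have "matchable (set (rotate1 xs)) R"
    proof (rule matchable_list_pairs)
      fix k assume "Suc (2 * k) < length (rotate1 xs)"
      then show "(rotate1 xs ! (2 * k), rotate1 xs ! Suc (2 * k)) \<in> R"
        using odd[of k] by (simp add: nth_rotate1)
    qed (use xs R in auto)
    then show ?thesis by simp
  qed
qed

section \<open>Robust matchability of composed graphs\<close>

lemma pverts_cycle_graph [simp]: "pverts (cycle_graph xs) = set xs"
  by (simp add: cycle_graph_def)

lemma pverts_identify_graph [simp]: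
  "pverts (identify_graph H F v) = (\<Union>u\<in>pverts H. pverts (F u))"
  by (simp add: identify_graph_def)

text \<open>Mapping everything outside \<open>F u\<close> to \<open>v u\<close> retracts a connected spanning subgraph of
  \<open>H[F\<^sub>1, \<dots>, F\<^sub>p]\<close> onto its part in \<open>F u\<close>, which is therefore connected.\<close>

lemma robustly_matchable_identify:
  assumes H: "parcs H \<subseteq> pverts H \<times> pverts H" "irrefl (parcs H)"
    and F: "\<And>u. u \<in> pverts H \<Longrightarrow> parcs (F u) \<subseteq> pverts (F u) \<times> pverts (F u)"
    and rob: "\<And>u. u \<in> pverts H \<Longrightarrow> robustly_matchable (pverts (F u)) (parcs (F u))"
    and disj: "disjoint_family_on (\<lambda>u. pverts (F u)) (pverts H)"
    and v: "\<And>u. u \<in> pverts H \<Longrightarrow> v u \<in> pverts (F u)"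
  shows "robustly_matchable (pverts (identify_graph H F v)) (parcs (identify_graph H F v))"
  unfolding robustly_matchable_def
proof (intro allI impI)
  let ?V = "pverts (identify_graph H F v)"
  fix R assume R: "R \<subseteq> parcs (identify_graph H F v)" "sym R" "cut_connected ?V R"
  have same: "u = w" if "x \<in> pverts (F u)" "x \<in> pverts (F w)" "u \<in> pverts H" "w \<in> pverts H" for x u w
    using disj that unfolding disjoint_family_on_def by blast
  \<comment> \<open>The part \<open>F u\<close> can be left only through \<open>v u\<close>.\<close>
  have arc: "(x, y) \<in> parcs (F u) \<or> x = v u" if xy: "(x, y) \<in> R" "u \<in> pverts H" "x \<in> pverts (F u)" for x y u
  proof -
    consider w where "w \<in> pverts H" "(x, y) \<in> parcs (F w)"
      | w z where "x = v w" "y = v z" "(w, z) \<in> parcs H"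
      using xy R(1) unfolding identify_graph_def by auto
    then show ?thesis
    proof cases
      case 1
      then show ?thesis using F[of w] same[of x u w] xy by auto
    next
      case 2
      then have "w \<in> pverts H" using H by blast
      then show ?thesis using 2 same[of x u w] v[of w] xy by auto
    qed
  qed
  \<comment> \<open>Arcs of \<open>H\<close> join distinct parts because \<open>H\<close> has no
    loops and the parts are disjoint; hence inside one part only its own arcs remain.\<close>
  have inner: "(x, y) \<in> parcs (F u)"
    if xy: "(x, y) \<in> R" "u \<in> pverts H" "x \<in> pverts (F u)" "y \<in> pverts (F u)" for x y u
  proof -
    consider w where "w \<in> pverts H" "(x, y) \<in> parcs (F w)"
      | w z where "x = v w" "y = v z" "(w, z) \<in> parcs H"
      using xy R(1) unfolding identify_graph_def by auto
    then show ?thesis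
    proof cases
      case 1
      then show ?thesis using F[of w] same[of x u w] xy by auto
    next
      case 2
      then have "w \<in> pverts H" "z \<in> pverts H" "w \<noteq> z" using H by (auto simp: irrefl_def)
      then show ?thesis using 2 same[of x u w] same[of y u z] v[of w] v[of z] xy by auto
    qed
  qed
  have "matchable (pverts (F u)) R" if u: "u \<in> pverts H" for u
  proof -
    let ?D = "pverts (F u)"
    let ?R = "R \<inter> ?D \<times> ?D"
    have symR: "sym ?R" using R(2) by (auto simp: sym_def)
    have "cut_connected ?D ?R"
    proof (rule cut_connected_rootI[OF symR v[OF u]])
      fix S assume S: "S \<subseteq> ?D" "v u \<in> S"
        "\<And>a b. a \<in> S \<Longrightarrow> b \<in> ?D \<Longrightarrow> (a, b) \<in> ?R \<Longrightarrow> b \<in> S"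
      \<comment> \<open>Everything outside the part is added to \<open>S\<close>. The result is
        closed, because an arc entering the part from outside ends at \<open>v u\<close>, which lies
        in \<open>S\<close>.\<close>
      have "S \<union> (?V - ?D) = ?V"
      proof (rule cut_connectedD[OF R(3)])
        fix a b assume ab: "a \<in> S \<union> (?V - ?D)" "b \<in> ?V" "(a, b) \<in> R"
        show "b \<in> S \<union> (?V - ?D)"
        proof (cases "b \<in> ?D")
          case True
          show ?thesis
          proof (cases "a \<in> ?D")
            case True
            then show ?thesis using ab S \<open>b \<in> ?D\<close> by blast
          next
            case False
            moreover have "(b, a) \<in> R" using ab R(2) by (auto dest: symD)
            ultimately have "b = v u" using arc[OF _ u \<open>b \<in> ?D\<close>] F[OF u] by blast
            then show ?thesis using S by blast
          qed
        qed (use ab(2) in blast)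
      next
        show "S \<union> (?V - ?D) \<subseteq> ?V" using S(1) u by auto
        show "v u \<in> S \<union> (?V - ?D)" using S(2) by blast
      qed
      moreover have "?D \<subseteq> ?V" using u by auto
      ultimately show "S = ?D" using S(1) by blast
    qed
    moreover have "?R \<subseteq> parcs (F u)" using inner[OF _ u] by auto
    ultimately have "matchable ?D ?R"
      using rob[OF u] symR unfolding robustly_matchable_def by blast
    then show ?thesis by (rule matchable_mono) blast
  qed
  then show "matchable ?V R"
    unfolding pverts_identify_graph by (rule matchable_UN[OF disj])
qed

text \<open>The containment of arcs is carried along in the induction because the composition step
  needs the arcs of each \<open>F u\<close> to stay in that part.\<close>

lemma family_G_robustly_matchable:
  assumes "G \<in> family_G"
  shows "parcs G \<subseteq> pverts G \<times> pverts G \<and> robustly_matchable (pverts G) (parcs G)"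
  using assms
proof (induction rule: family_G.induct)
  case (K2 G)
  then have G: "card (pverts G) = 2"
    "parcs G = {(u, v). (u, v) \<in> pverts G \<times> pverts G \<and> u \<noteq> v}"
    unfolding complete_digraph_def by simp_all
  then obtain u v where "pverts G = {u, v}" "u \<noteq> v" by (auto simp: card_2_iff)
  then show ?case using G robustly_matchable_pair[of u v] by auto
next
  case (even_cycle xs)
  have "parcs (cycle_graph xs) \<subseteq> set xs \<times> set xs"
    using even_cycle by (fastforce simp: cycle_graph_def symcl_def)
  then show ?case using robustly_matchable_even_cycle even_cycle by simp
next
  case (identify H F v)
  have H: "parcs H \<subseteq> pverts H \<times> pverts H" "irrefl (parcs H)"
    using identify(1) by (auto simp: pair_graph_iff)
  let ?V = "\<Union>u\<in>pverts H. pverts (F u)"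
  have F: "\<And>u. u \<in> pverts H \<Longrightarrow> parcs (F u) \<subseteq> pverts (F u) \<times> pverts (F u)"
    "\<And>u. u \<in> pverts H \<Longrightarrow> robustly_matchable (pverts (F u)) (parcs (F u))"
    using identify.IH by blast+
  have "(\<Union>u\<in>pverts H. parcs (F u)) \<subseteq> ?V \<times> ?V" using F(1) by blast
  moreover have "{(v u, v w) |u w. (u, w) \<in> parcs H} \<subseteq> ?V \<times> ?V" using H(1) identify(6) by blast
  ultimately have "parcs (identify_graph H F v) \<subseteq> ?V \<times> ?V" by (simp add: identify_graph_def)
  then show ?case using robustly_matchable_identify[OF H F identify(5,6)] by simp
qed

section \<open>Decomposition at a cut vertex\<close>

text \<open>An odd set cannot be invariant under a fixed-point-free involution.\<close>

lemma odd_matched_outside: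
  assumes "involutive_matching V R f" "finite V" "S \<subseteq> V" "odd (card S)"
  obtains a where "a \<in> S" "f a \<in> V - S" "(a, f a) \<in> R" "f (f a) = a"
proof -
  have "\<exists>a\<in>S. f a \<notin> S"
  proof (rule ccontr)
    assume "\<not> ?thesis"
    then have "even (card S)"
      using assms unfolding involutive_matching_def
      by (intro even_card_involution[of S f]) (auto intro: finite_subset)
    then show False using assms(4) by blast
  qed
  then show ?thesis using that assms(1,3) unfolding involutive_matching_def by blast
qed

locale ugraph =
  fixes V :: "'a set" and E :: "'a rel"
  assumes finite_V: "finite V" and E_subset: "E \<subseteq> V \<times> V" and sym_E: "sym E"
    and irrefl_E: "irrefl E"
begin

lemma E_sym: "(a, b) \<in> E \<Longrightarrow> (b, a) \<in> E"
  using sym_E by (rule symD)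

lemma E_V: "(a, b) \<in> E \<Longrightarrow> a \<in> V \<and> b \<in> V"
  using E_subset by blast

lemma E_irrefl: "(a, a) \<notin> E"
  using irrefl_E by (simp add: irrefl_def)

lemma sym_Restr: "sym (E \<inter> D \<times> D)"
  using sym_E by (auto simp: sym_def)

lemma ugraph_Restr: "D \<subseteq> V \<Longrightarrow> ugraph D (E \<inter> D \<times> D)"
  by unfold_locales
    (use finite_V E_subset irrefl_E sym_Restr in \<open>auto simp: irrefl_def intro: finite_subset\<close>)

text \<open>A connected spanning subgraph of \<open>D\<close> extends, by all edges not inside
  \<open>D\<close>, to one of the whole graph. The matching of the latter could leave
  \<open>D\<close> only at \<open>w\<close>, and then the odd set \<open>D - {w}\<close> would be
  matched within itself.\<close>

lemma robustly_matchable_part: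
  assumes conn: "cut_connected V E" and rob: "robustly_matchable V E"
    and D: "D \<subseteq> V" "w \<in> D" "even (card D)"
    and exit: "\<And>a b. a \<in> D \<Longrightarrow> b \<in> V - D \<Longrightarrow> (a, b) \<in> E \<Longrightarrow> a = w"
  shows "robustly_matchable D (E \<inter> D \<times> D)"
  unfolding robustly_matchable_def
proof (intro allI impI)
  fix R assume R: "R \<subseteq> E \<inter> D \<times> D" "sym R" "cut_connected D R"
  let ?K = "R \<union> (E - D \<times> D)"
  have "sym ?K" using R(2) sym_E by (auto simp: sym_def)
  moreover have "cut_connected V ?K"
  proof (rule cut_connected_rootI[OF \<open>sym ?K\<close>, of w])
    fix S assume S: "S \<subseteq> V" "w \<in> S" "\<And>a b. a \<in> S \<Longrightarrow> b \<in> V \<Longrightarrow> (a, b) \<in> ?K \<Longrightarrow> b \<in> S"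
    have SD: "S \<inter> D = D"
      by (rule cut_connectedD[OF R(3), of _ w]) (use S D in auto)
    show "S = V"
    proof (rule cut_connectedD[OF conn S(1,2)])
      fix a b assume "a \<in> S" "b \<in> V" "(a, b) \<in> E"
      then show "b \<in> S" using S(3)[of a b] SD by blast
    qed
  qed (use D in blast)
  ultimately obtain f where f: "involutive_matching V ?K f"
    using robustly_matchableD[OF rob, of ?K] R(1) by blast
  have ff: "f a \<in> V" "f a \<noteq> a" "(a, f a) \<in> ?K" "f (f a) = a" if "a \<in> D" for a
    using f that D(1) unfolding involutive_matching_def by auto
  have stay: "f a \<in> D" if a: "a \<in> D" "a \<noteq> w" for a
    using ff[OF a(1)] exit[OF a(1), of "f a"] a R(1) by blast
  have "f w \<in> D"
  proof (rule ccontr)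
    assume out: "f w \<notin> D"
    have "even (card (D - {w}))"
    proof (rule even_card_involution[of _ f])
      fix a assume a: "a \<in> D - {w}"
      then have "f a \<noteq> w" using out ff(4)[of a] by auto
      then show "f a \<in> D - {w} \<and> f a \<noteq> a \<and> f (f a) = a" using a stay[of a] ff[of a] by auto
    qed (use finite_V D in \<open>auto intro: finite_subset\<close>)
    moreover have "card D = Suc (card (D - {w}))"
      using D finite_V by (intro card.remove) (auto intro: finite_subset)
    ultimately show False using D(3) by simp
  qed
  then have "f a \<in> D" if "a \<in> D" for a using stay that by (cases "a = w") auto
  then have "involutive_matching D R f"
    using ff unfolding involutive_matching_def by blast
  then show "matchable D R" unfolding matchable_def by blast
qed

text \<open>Keep, between the odd part \<open>D\<close> and its complement, only the edge \<open>(x, y)\<close>: it has to be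
  a matching edge, so \<open>D' - {y}\<close> is matched within itself.\<close>

lemma odd_part_propagates:
  assumes rob: "robustly_matchable V E"
    and D: "D \<subseteq> V" "x \<in> D" "odd (card D)" "cut_connected D E" "cut_connected (V - D) E"
    and D': "D' \<subseteq> V - D" "y \<in> D'"
      "\<And>a b. a \<in> D' \<Longrightarrow> b \<in> V - D' \<Longrightarrow> (a, b) \<in> E \<Longrightarrow> a = y"
    and xy: "(x, y) \<in> E"
  shows "odd (card D')"
proof -
  let ?K = "E \<inter> D \<times> D \<union> E \<inter> (V - D) \<times> (V - D) \<union> {(x, y), (y, x)}"
  have sym: "sym ?K" using sym_E by (auto simp: sym_def)
  have "cut_connected (D \<union> (V - D)) ?K"
  proof (rule cut_connected_Un[OF _ _ sym, where x = x and y = y])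
    show "cut_connected D ?K"
      by (rule cut_connected_mono[OF D(4)]) blast
    show "cut_connected (V - D) ?K"
      by (rule cut_connected_mono[OF D(5)]) blast
  qed (use D D' in auto)
  moreover have "D \<union> (V - D) = V" using D(1) by blast
  ultimately have "cut_connected V ?K" by simp
  moreover have "?K \<subseteq> E" using xy E_sym by blast
  ultimately obtain f where f: "involutive_matching V ?K f"
    using robustly_matchableD[OF rob _ sym] by metis
  \<comment> \<open>\<open>(x, y)\<close> is the only arc of \<open>?K\<close> from \<open>D\<close>
    to its complement.\<close>
  obtain a where a: "a \<in> D" "f a \<in> V - D" "(a, f a) \<in> ?K" "f (f a) = a"
    using odd_matched_outside[OF f finite_V D(1,3)] .
  then have fy: "f y = x" "f x = y" using D(2) D'(1,2) by auto
  have "even (card (D' - {y}))"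
  proof (rule even_card_involution[of _ f])
    fix z assume z: "z \<in> D' - {y}"
    then have "z \<in> V" using D' by blast
    then have fz: "f z \<in> V" "f z \<noteq> z" "(z, f z) \<in> ?K" "f (f z) = z"
      using f unfolding involutive_matching_def by auto
    have "f z \<noteq> y" using fz(4) fy z D(2) D'(1) by auto
    moreover have "f z \<in> D'"
    proof (rule ccontr)
      assume "f z \<notin> D'"
      moreover have "(z, f z) \<in> E" using fz(3) \<open>?K \<subseteq> E\<close> by blast
      ultimately have "z = y" using D'(3)[of z "f z"] z fz(1) by blast
      then show False using z by blast
    qed
    ultimately show "f z \<in> D' - {y} \<and> f z \<noteq> z \<and> f (f z) = z" using fz by blast
  qed (use finite_V D' in \<open>auto intro: finite_subset\<close>)
  moreover have "card D' = Suc (card (D' - {y}))"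
    using D' finite_V by (intro card.remove) (auto intro: finite_subset)
  ultimately show ?thesis by simp
qed

text \<open>\<open>V - {c}\<close> has odd size and splits into two nonempty sets with no edge
  between them; one of the two is even.\<close>

lemma even_part_at_cut_vertex:
  assumes conn: "cut_connected V E" and even: "even (card V)"
    and c: "c \<in> V" "V \<noteq> {c}" "\<not> cut_connected (V - {c}) E"
  obtains U where "U \<subseteq> V - {c}" "U \<noteq> {}" "even (card U)"
    "\<And>a b. a \<in> U \<Longrightarrow> (a, b) \<in> E \<Longrightarrow> b \<in> insert c U"
proof -
  have "V - {c} \<noteq> {}" using c by blast
  then obtain S where S: "S \<subseteq> V - {c}" "S \<noteq> {}" "S \<noteq> V - {c}"
    and closed: "\<And>x y. x \<in> S \<Longrightarrow> y \<in> V - {c} - S \<Longrightarrow> (x, y) \<notin> E"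
    using c(3) unfolding cut_connected_def by blast
  let ?T = "V - {c} - S"
  have fin: "finite S" "finite ?T" using S(1) finite_V by (auto intro: finite_subset)
  have "V = insert c (S \<union> ?T)" using S(1) c by blast
  then have "card V = card (insert c (S \<union> ?T))" by simp
  also have "\<dots> = Suc (card (S \<union> ?T))" using fin S(1) by (intro card_insert_disjoint) auto
  also have "card (S \<union> ?T) = card S + card ?T" using fin by (intro card_Un_disjoint) auto
  finally have "odd (card S + card ?T)" using even by simp
  then consider "even (card S)" | "even (card ?T)" by fastforce
  then show ?thesis
  proof cases
    case 1
    show ?thesis
    proof (rule that[OF S(1,2) 1])
      fix a b assume "a \<in> S" "(a, b) \<in> E"
      then show "b \<in> insert c S" using closed[of a b] E_V by blast
    qed
  next
    case 2
    show ?thesis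
    proof (rule that[OF _ _ 2])
      show "?T \<subseteq> V - {c}" "?T \<noteq> {}" using S by auto
      fix a b assume "a \<in> ?T" "(a, b) \<in> E"
      then show "b \<in> insert c ?T" using closed[of b a] E_V E_sym by blast
    qed
  qed
qed

end

text \<open>\<open>U\<close> is a union of components of \<open>V - {c}\<close>. The vertices of \<open>U\<close> that \<open>w\<close> separates
  from \<open>c\<close> form \<open>branch w\<close>; the roots of the maximal branches, together with \<open>c\<close>, are the vertices
  of the graph \<open>H\<close> in a decomposition \<open>H[F\<^sub>1, \<dots>, F\<^sub>p]\<close> of the whole graph.\<close>

locale cut_part = ugraph +
  fixes c :: 'a and U :: "'a set"
  assumes conn: "cut_connected V E" and c_V: "c \<in> V" and U_subset: "U \<subseteq> V - {c}"
    and U_nonempty: "U \<noteq> {}"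
    and U_closed: "\<And>a b. a \<in> U \<Longrightarrow> (a, b) \<in> E \<Longrightarrow> b \<in> insert c U"
begin

text \<open>The root \<open>c\<close> gets the part outside \<open>U\<close> by convention, as
  reachability from \<open>c\<close> without \<open>c\<close> is meaningless. A vertex
  \<open>w\<close> of \<open>U\<close> lies in its own branch, since walks from \<open>c\<close>
  avoiding \<open>w\<close> do not reach it.\<close>

definition branch :: "'a \<Rightarrow> 'a set" where
  "branch w = (if w = c then V - U else V - reach E (V - {w}) c)"

text \<open>Maximality is tested on roots alone: inside \<open>U\<close>, \<open>w\<close> lies in
  \<open>branch w'\<close> exactly when \<open>branch w\<close> is contained in
  \<open>branch w'\<close>.\<close>

definition roots :: "'a set" where
  "roots = insert c {w \<in> U. \<forall>w'\<in>U. w \<in> branch w' \<longrightarrow> w' = w}"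

section \<open>Branches are connected and attached at a single vertex\<close>

lemma branch_c: "branch c = V - U"
  by (simp add: branch_def)

lemma branch_U: "w \<in> U \<Longrightarrow> branch w = V - reach E (V - {w}) c"
  using U_subset by (auto simp: branch_def)

lemma reach_c_subset: "w \<in> U \<Longrightarrow> reach E (V - {w}) c \<subseteq> V - {w}"
  by (rule reach_subset) (use c_V U_subset in auto)

lemma reach_c_step:
  "w \<in> U \<Longrightarrow> a \<in> reach E (V - {w}) c \<Longrightarrow> b \<in> V - {w} \<Longrightarrow> (a, b) \<in> E
    \<Longrightarrow> b \<in> reach E (V - {w}) c"
  by (rule reach_step) (use c_V U_subset in auto)

lemma roots_subset: "roots \<subseteq> insert c U"
  unfolding roots_def by blast

lemma branch_subset_V: "branch w \<subseteq> V"
  unfolding branch_def by auto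

lemma root_in_branch: "w \<in> insert c U \<Longrightarrow> w \<in> branch w"
  using reach_c_subset[of w] branch_U[of w] branch_c c_V U_subset by (cases "w = c") auto

text \<open>\<open>U\<close> is joined to the rest only at \<open>c\<close>, so adding
  \<open>U\<close> to a closed set through \<open>c\<close> keeps it closed.\<close>

lemma cut_connected_rest: "cut_connected (V - U) E"
proof (rule cut_connected_rootI[OF sym_E])
  show "c \<in> V - U" using c_V U_subset by blast
  fix S assume S: "S \<subseteq> V - U" "c \<in> S" "\<And>a b. a \<in> S \<Longrightarrow> b \<in> V - U \<Longrightarrow> (a, b) \<in> E \<Longrightarrow> b \<in> S"
  have "S \<union> U = V"
    by (rule cut_connectedD[OF conn, of _ c]) (use S U_subset U_closed in blast)+
  then show "S = V - U" using S(1) by blast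
qed

text \<open>The rest \<open>V - U\<close> is connected, contains \<open>c\<close> and avoids
  \<open>w\<close>, so it is reached from \<open>c\<close> entirely.\<close>

lemma branch_subset_U:
  assumes "w \<in> U"
  shows "branch w \<subseteq> U"
proof -
  have "reach E (V - {w}) c \<inter> (V - U) = V - U"
  proof (rule cut_connectedD[OF cut_connected_rest])
    show "c \<in> reach E (V - {w}) c \<inter> (V - U)" using reach_root c_V U_subset by fastforce
    fix a b assume "a \<in> reach E (V - {w}) c \<inter> (V - U)" "b \<in> V - U" "(a, b) \<in> E"
    then show "b \<in> reach E (V - {w}) c \<inter> (V - U)" using reach_c_step[OF assms, of a b] assms by blast
  qed blast
  then show ?thesis using branch_U[OF assms] by blast
qed

lemma c_notin_branch: "w \<in> U \<Longrightarrow> c \<notin> branch w"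
  using branch_subset_U U_subset by blast

text \<open>A vertex next to the component of \<open>c\<close> in \<open>V - {w}\<close> belongs to
  that component or is \<open>w\<close>; for \<open>w = c\<close>, closedness of \<open>U\<close>
  gives the claim.\<close>

lemma branch_exit:
  assumes "w \<in> insert c U" "a \<in> branch w" "b \<in> V - branch w" "(a, b) \<in> E"
  shows "a = w"
proof (cases "w = c")
  case True
  then have "b \<in> U" "a \<notin> U" using assms branch_c by auto
  then show ?thesis using U_closed[of b a] assms E_sym True by blast
next
  case False
  then have w: "w \<in> U" using assms(1) by blast
  then have "b \<in> reach E (V - {w}) c" "a \<in> V" "a \<notin> reach E (V - {w}) c"
    using assms branch_U by auto
  then show ?thesis using reach_c_step[OF w, of b a] assms(4) E_sym by blast
qed

lemma cut_connected_outside_branch: "w \<in> U \<Longrightarrow> cut_connected (V - branch w) E"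
proof -
  assume w: "w \<in> U"
  have "V - branch w = reach E (V - {w}) c" using branch_U[OF w] reach_c_subset[OF w] by blast
  moreover have "c \<in> V - {w}" using w c_V U_subset by blast
  ultimately show ?thesis using reach_connected[OF sym_E] by metis
qed

text \<open>As arcs cross the boundary of \<open>branch w\<close> only at \<open>w\<close>, a closed
  subset of the branch through \<open>w\<close> stays closed when everything outside the branch is
  added.\<close>

lemma cut_connected_branch:
  assumes "w \<in> insert c U"
  shows "cut_connected (branch w) E"
proof (cases "w = c")
  case False
  then have w: "w \<in> U" using assms by blast
  show ?thesis
  proof (rule cut_connected_rootI[OF sym_E root_in_branch[OF assms]])
    fix S assume S: "S \<subseteq> branch w" "w \<in> S"
      "\<And>a b. a \<in> S \<Longrightarrow> b \<in> branch w \<Longrightarrow> (a, b) \<in> E \<Longrightarrow> b \<in> S"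
    have "S \<union> (V - branch w) = V"
    proof (rule cut_connectedD[OF conn, of _ w])
      fix a b assume ab: "a \<in> S \<union> (V - branch w)" "b \<in> V" "(a, b) \<in> E"
      show "b \<in> S \<union> (V - branch w)"
      proof (cases "a \<in> S")
        case False
        then show ?thesis using branch_exit[OF assms, of b a] ab S(2) E_sym by blast
      qed (use ab S in blast)
    qed (use S branch_subset_V in blast)+
    then show "S = branch w" using S(1) branch_subset_V by blast
  qed
qed (use branch_c cut_connected_rest in simp)

text \<open>An arc leaving the intersection would leave one of the branches and hence start at its
  root, which the other branch does not contain. By connectedness a nonempty intersection would be
  all of \<open>V\<close>, but it misses \<open>c\<close>.\<close>

lemma branches_laminar:
  assumes "w \<in> U" "w' \<in> U" "w \<notin> branch w'" "w' \<notin> branch w"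
  shows "branch w \<inter> branch w' = {}"
proof (rule ccontr)
  assume "branch w \<inter> branch w' \<noteq> {}"
  then obtain z where z: "z \<in> branch w \<inter> branch w'" by blast
  have "branch w \<inter> branch w' = V"
  proof (rule cut_connectedD[OF conn _ z])
    fix a b assume "a \<in> branch w \<inter> branch w'" "b \<in> V" "(a, b) \<in> E"
    then show "b \<in> branch w \<inter> branch w'"
      using branch_exit[of w a b] branch_exit[of w' a b] assms by blast
  qed (use branch_subset_V in blast)
  then show False using c_notin_branch[OF assms(1)] c_V by blast
qed

text \<open>A vertex that \<open>c\<close> reaches without \<open>w'\<close> is also reached without
  \<open>w\<close>, because \<open>w\<close> itself is cut off by \<open>w'\<close> and so never
  occurs on such a walk.\<close>

lemma branch_mono:
  assumes "w \<in> U" "w' \<in> U" "w \<in> branch w'"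
  shows "branch w \<subseteq> branch w'"
proof -
  have "reach E (V - {w'}) c \<subseteq> reach E (V - {w'}) c \<inter> reach E (V - {w}) c"
  proof (rule reach_least)
    fix a b assume ab: "a \<in> reach E (V - {w'}) c \<inter> reach E (V - {w}) c" "b \<in> V - {w'}" "(a, b) \<in> E"
    then have "b \<in> reach E (V - {w'}) c" using reach_c_step[OF assms(2)] by blast
    moreover from this have "b \<noteq> w" using assms(3) branch_U[OF assms(2)] by blast
    ultimately show "b \<in> reach E (V - {w'}) c \<inter> reach E (V - {w}) c"
      using reach_c_step[OF assms(1)] ab by blast
  qed (simp add: reach_root)
  then show ?thesis using branch_U assms by auto
qed

text \<open>For distinct roots the two branches would be equal, and an arc leaving the common set
  would start at both roots. So nothing leaves it, although it misses \<open>c\<close>.\<close>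

lemma branch_antisym:
  assumes "w \<in> U" "w' \<in> U" "w \<in> branch w'" "w' \<in> branch w"
  shows "w = w'"
proof (rule ccontr)
  assume ne: "w \<noteq> w'"
  have eq: "branch w = branch w'" using branch_mono assms by blast
  have "branch w = V"
  proof (rule cut_connectedD[OF conn branch_subset_V root_in_branch])
    fix a b assume "a \<in> branch w" "b \<in> V" "(a, b) \<in> E"
    then show "b \<in> branch w"
      using branch_exit[of w a b] branch_exit[of w' a b] assms eq ne by blast
  qed (use assms in blast)
  then show False using c_notin_branch[OF assms(1)] c_V by blast
qed

text \<open>Among the branches containing a vertex of \<open>U\<close>, one of largest size has its
  root in \<open>roots\<close>; \<open>branch c\<close> takes the remaining vertices.\<close>

lemma branches_cover: "(\<Union>w\<in>roots. branch w) = V"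
proof
  show "(\<Union>w\<in>roots. branch w) \<subseteq> V" using branch_subset_V by blast
  show "V \<subseteq> (\<Union>w\<in>roots. branch w)"
  proof
    fix z assume z: "z \<in> V"
    show "z \<in> (\<Union>w\<in>roots. branch w)"
    proof (cases "z \<in> U")
      case True
      have fin: "finite (branch w)" for w using finite_V branch_subset_V finite_subset by metis
      let ?P = "\<lambda>w. w \<in> U \<and> z \<in> branch w"
      have "\<exists>w. ?P w \<and> (\<forall>w'. ?P w' \<longrightarrow> card (branch w') \<le> card (branch w))"
      proof (rule Lattices_Big.ex_has_greatest_nat[of _ z _ "Suc (card V)"])
        show "?P z" using True root_in_branch by blast
        show "\<forall>w. ?P w \<longrightarrow> card (branch w) < Suc (card V)"
          using card_mono[OF finite_V branch_subset_V] by (simp add: less_Suc_eq_le)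
      qed
      then obtain w where w: "w \<in> U" "z \<in> branch w"
        and max: "\<And>w'. w' \<in> U \<Longrightarrow> z \<in> branch w' \<Longrightarrow> card (branch w') \<le> card (branch w)"
        by blast
      have "w' = w" if w': "w' \<in> U" "w \<in> branch w'" for w'
      proof -
        have sub: "branch w \<subseteq> branch w'" using branch_mono w w' by blast
        then have "branch w = branch w'"
          using max[of w'] w w' fin by (intro card_seteq) auto
        then show ?thesis using branch_antisym w w' root_in_branch by blast
      qed
      then have "w \<in> roots" using w unfolding roots_def by blast
      then show ?thesis using w by blast
    next
      case False
      then show ?thesis using z branch_c unfolding roots_def by blast
    qed
  qed
qed

lemma branches_disjoint: "disjoint_family_on branch roots"
  unfolding disjoint_family_on_def
proof (intro ballI impI)
  fix w w' assume w: "w \<in> roots" "w' \<in> roots" "w \<noteq> w'"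
  consider "w = c" "w' \<in> U" | "w' = c" "w \<in> U" | "w \<in> U" "w' \<in> U"
    using w roots_subset by blast
  then show "branch w \<inter> branch w' = {}"
  proof cases
    case 3
    then have "w \<notin> branch w'" "w' \<notin> branch w"
      using w U_subset unfolding roots_def by auto
    then show ?thesis using branches_laminar 3 by blast
  qed (use branch_subset_U branch_c in blast)+
qed

section \<open>The decomposition into maximal branches\<close>

lemma edge_between_branches:
  assumes "w \<in> roots" "w' \<in> roots" "w \<noteq> w'" "a \<in> branch w" "b \<in> branch w'" "(a, b) \<in> E"
  shows "a = w" "b = w'"
proof -
  have "branch w \<inter> branch w' = {}" using branches_disjoint assms by (auto simp: disjoint_family_on_def)
  then show "a = w" "b = w'"
    using branch_exit[of w a b] branch_exit[of w' b a] assms roots_subset branch_subset_V E_sym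
    by blast+
qed

text \<open>The right-hand side is the arc set of \<open>identify_graph\<close> for the graph
  induced on \<open>roots\<close>, with each root as its own attachment vertex.\<close>

lemma edges_decomposition:
  "E = (\<Union>w\<in>roots. E \<inter> branch w \<times> branch w) \<union> E \<inter> roots \<times> roots" (is "_ = ?R")
proof
  show "E \<subseteq> ?R"
  proof
    fix e assume e: "e \<in> E"
    obtain a b where ab: "e = (a, b)" by (cases e)
    then have "a \<in> V" "b \<in> V" using e E_V by auto
    then obtain w w' where w: "w \<in> roots" "a \<in> branch w" "w' \<in> roots" "b \<in> branch w'"
      using branches_cover by blast
    then show "e \<in> ?R" using edge_between_branches[of w w' a b] e ab by (cases "w = w'") auto
  qed
qed blast

lemma root_in_own_branch: "w \<in> roots \<Longrightarrow> w \<in> branch w"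
  using root_in_branch roots_subset by blast

text \<open>The union of the branches over a closed set of roots is closed in the whole graph, since
  edges between branches join their roots.\<close>

lemma cut_connected_roots: "cut_connected roots E"
proof (rule cut_connected_rootI[OF sym_E])
  show "c \<in> roots" by (simp add: roots_def)
  fix S assume S: "S \<subseteq> roots" "c \<in> S" "\<And>a b. a \<in> S \<Longrightarrow> b \<in> roots \<Longrightarrow> (a, b) \<in> E \<Longrightarrow> b \<in> S"
  have eq: "(\<Union>w\<in>S. branch w) = V"
  proof (rule cut_connectedD[OF conn])
    show "(\<Union>w\<in>S. branch w) \<subseteq> V" using branch_subset_V by blast
    show "c \<in> (\<Union>w\<in>S. branch w)" using S(1,2) root_in_own_branch by blast
    fix a b assume ab: "a \<in> (\<Union>w\<in>S. branch w)" "b \<in> V" "(a, b) \<in> E"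
    then obtain w where w: "w \<in> S" "a \<in> branch w" by blast
    obtain w' where w': "w' \<in> roots" "b \<in> branch w'" using ab branches_cover by blast
    show "b \<in> (\<Union>w\<in>S. branch w)"
    proof (cases "w = w'")
      case False
      then have "a = w" "b = w'" using edge_between_branches[of w w' a b] w w' S(1) ab by auto
      then show ?thesis using S(3)[of w w'] w w' ab by blast
    qed (use w w' in blast)
  qed
  have "w' \<in> S" if w': "w' \<in> roots" for w'
  proof -
    have "w' \<in> V" using w' root_in_own_branch branch_subset_V by blast
    then obtain w where "w \<in> S" "w' \<in> branch w" using eq by blast
    moreover from this have "w = w'"
      using disjoint_family_onD[OF branches_disjoint, of w w'] root_in_own_branch[OF w'] w' S(1)
      by blast
    ultimately show ?thesis by simp
  qed
  then show "S = roots" using S(1) by blast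
qed

lemma card_roots: "2 \<le> card roots"
proof -
  obtain z where z: "z \<in> U" using U_nonempty by blast
  then have "z \<in> V" using U_subset by blast
  then obtain w where w: "w \<in> roots" "z \<in> branch w" using branches_cover by blast
  have "w \<noteq> c" using w z branch_c by auto
  moreover have "c \<in> roots" by (simp add: roots_def)
  ultimately have "{c, w} \<subseteq> roots" "card {c, w} = 2" using w by auto
  moreover have "finite roots"
    using roots_subset U_subset c_V finite_V by (meson finite_insert finite_subset finite_Diff)
  ultimately show ?thesis by (metis card_mono)
qed

lemma card_branch_less: "w \<in> roots \<Longrightarrow> card (branch w) < card V"
proof (rule psubset_card_mono[OF finite_V])
  assume "w \<in> roots"
  then consider "w = c" | "w \<in> U" using roots_subset by blast
  then show "branch w \<subset> V"
  proof cases
    case 1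
    then show ?thesis using branch_c U_nonempty U_subset by auto
  next
    case 2
    then show ?thesis using c_notin_branch c_V branch_subset_V by blast
  qed
qed

text \<open>The branch at \<open>c\<close>, namely \<open>V - U\<close>, is even. Evenness spreads
  along the edges of the connected graph on \<open>roots\<close>, since an odd branch forces
  adjacent branches to be odd.\<close>

lemma branches_even:
  assumes rob: "robustly_matchable V E" and even: "even (card V)" "even (card U)"
    and "w \<in> roots"
  shows "even (card (branch w))"
proof -
  have "{w \<in> roots. even (card (branch w))} = roots"
  proof (rule cut_connectedD[OF cut_connected_roots])
    have "finite U" using U_subset finite_V by (auto intro: finite_subset)
    then have "card (V - U) = card V - card U" using U_subset by (intro card_Diff_subset) auto
    then have "even (card (V - U))" using even by simp
    then show "c \<in> {w \<in> roots. even (card (branch w))}" by (simp add: roots_def branch_c)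
    fix a b assume ab: "a \<in> {w \<in> roots. even (card (branch w))}" "b \<in> roots" "(a, b) \<in> E"
    have "even (card (branch b))"
    proof (rule ccontr)
      assume odd: "odd (card (branch b))"
      then have "b \<noteq> c" using \<open>even (card (V - U))\<close> branch_c by auto
      then have b: "b \<in> U" using ab roots_subset by blast
      have "a \<noteq> b" using ab E_irrefl by blast
      then have "branch a \<inter> branch b = {}"
        using branches_disjoint ab by (auto simp: disjoint_family_on_def)
      then have "branch a \<subseteq> V - branch b" using branch_subset_V by blast
      moreover have "a \<in> insert c U" using ab roots_subset by blast
      ultimately have "odd (card (branch a))"
        using odd_part_propagates[OF rob branch_subset_V root_in_branch odd cut_connected_branch
            cut_connected_outside_branch[OF b], of "branch a" a] b root_in_branch branch_exit
          E_sym ab by blast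
      then show False using ab by blast
    qed
    then show "b \<in> {w \<in> roots. even (card (branch w))}" using ab by blast
  qed blast
  then show ?thesis using assms(4) by blast
qed

end

section \<open>Graphs without cut vertices\<close>

context ugraph
begin

section \<open>Separation by one vertex, and forks\<close>

lemma separation_sym:
  assumes "x \<in> W - {w}" "y \<in> W - {w}"
  shows "y \<in> reach E (W - {w}) x \<longleftrightarrow> x \<in> reach E (W - {w}) y"
  using sym_rtrancl[OF sym_Restr[of "W - {w}"]] unfolding reach_def by (auto dest: symD)

text \<open>If each of \<open>a\<close>, \<open>b\<close> cut the other off from \<open>r\<close>,
  no arc could leave the set of vertices reached from \<open>r\<close> both without \<open>a\<close>
  and without \<open>b\<close>: a step to \<open>a\<close> would reach \<open>a\<close> without
  \<open>b\<close>, and symmetrically.\<close>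

lemma separation_antisym:
  assumes conn: "cut_connected W E" and W: "r \<in> W" "a \<in> W" "a \<noteq> b" "r \<noteq> a" "r \<noteq> b"
    and b: "b \<notin> reach E (W - {a}) r"
  shows "a \<in> reach E (W - {b}) r"
proof (rule ccontr)
  assume a: "a \<notin> reach E (W - {b}) r"
  let ?X = "reach E (W - {a}) r" and ?Y = "reach E (W - {b}) r"
  have X: "z \<in> ?X" if "y \<in> ?X" "z \<in> W - {a}" "(y, z) \<in> E" for y z
    by (rule reach_step[OF that(1) _ that(2,3)]) (use W in blast)
  have Y: "z \<in> ?Y" if "y \<in> ?Y" "z \<in> W - {b}" "(y, z) \<in> E" for y z
    by (rule reach_step[OF that(1) _ that(2,3)]) (use W in blast)
  have sub: "?X \<subseteq> W - {a}" by (rule reach_subset) (use W in blast)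
  have "?X \<inter> ?Y = W"
  proof (rule cut_connectedD[OF conn, of _ r])
    fix y z assume yz: "y \<in> ?X \<inter> ?Y" "z \<in> W" "(y, z) \<in> E"
    then consider "z = a" | "z = b" | "z \<in> W - {a}" "z \<in> W - {b}" by blast
    then show "z \<in> ?X \<inter> ?Y"
    proof cases
      case 1
      then have "z \<in> ?Y" using Y[of y z] yz W by blast
      then show ?thesis using 1 a by blast
    next
      case 2
      then have "z \<in> ?X" using X[of y z] yz W by blast
      then show ?thesis using 2 b by blast
    next
      case 3
      then show ?thesis using X[of y z] Y[of y z] yz by blast
    qed
  qed (use sub reach_root[of r E] in auto)
  then show False using sub W by blast
qed

text \<open>For \<open>r\<close> in \<open>W - {a, b}\<close>, the component of \<open>r\<close>
  there has edges to both \<open>a\<close> and \<open>b\<close>, so it serves as a stem on which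
  both hang independently.\<close>

definition fork :: "'a set \<Rightarrow> 'a \<Rightarrow> 'a \<Rightarrow> 'a \<Rightarrow> bool" where
  "fork W r a b \<longleftrightarrow> (\<exists>u\<in>reach E (W - {a, b}) r. (u, a) \<in> E) \<and>
     (\<exists>u\<in>reach E (W - {a, b}) r. (u, b) \<in> E)"

text \<open>A walk from \<open>r\<close> to \<open>a\<close> that avoids \<open>b\<close> first
  arrives at \<open>a\<close> from a vertex of the component of \<open>r\<close> in
  \<open>W - {a, b}\<close>.\<close>

lemma fork_half:
  assumes "r \<in> W" "a \<in> W" "r \<noteq> a" "r \<noteq> b" "a \<noteq> b" "a \<in> reach E (W - {b}) r"
  shows "\<exists>u\<in>reach E (W - {a, b}) r. (u, a) \<in> E"
proof (rule ccontr)
  assume no: "\<not> ?thesis"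
  have "reach E (W - {b}) r \<subseteq> reach E (W - {a, b}) r"
  proof (rule reach_least[OF reach_root])
    fix y z assume yz: "y \<in> reach E (W - {a, b}) r" "z \<in> W - {b}" "(y, z) \<in> E"
    then have "z \<noteq> a" using no by blast
    then show "z \<in> reach E (W - {a, b}) r"
      using yz assms by (intro reach_step[OF yz(1)]) auto
  qed
  moreover have "reach E (W - {a, b}) r \<subseteq> W - {a, b}"
    by (rule reach_subset) (use assms in auto)
  ultimately show False using assms(6) by blast
qed

lemma forkI:
  assumes "r \<in> W" "a \<in> W" "b \<in> W" "r \<noteq> a" "r \<noteq> b" "a \<noteq> b"
    and "a \<in> reach E (W - {b}) r" "b \<in> reach E (W - {a}) r"
  shows "fork W r a b"
  using fork_half[of r W a b] fork_half[of r W b a] assms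
  unfolding fork_def by (simp add: insert_commute)

text \<open>At most one of three vertices separates the two others. If there is one, it is the root of
  a fork; otherwise any of the three is.\<close>

lemma fork_exists:
  assumes conn: "cut_connected W E" and W: "x \<in> W" "y \<in> W" "z \<in> W"
    and ne: "x \<noteq> y" "x \<noteq> z" "y \<noteq> z"
  shows "fork W x y z \<or> fork W y x z \<or> fork W z x y"
proof -
  \<comment> \<open>\<open>?s w a b\<close> says that \<open>w\<close> separates \<open>a\<close>
    from \<open>b\<close> in \<open>W\<close>.\<close>
  let ?s = "\<lambda>w a b. b \<notin> reach E (W - {w}) a"
  have sym: "?s x y z \<longleftrightarrow> ?s x z y" "?s y x z \<longleftrightarrow> ?s y z x" "?s z x y \<longleftrightarrow> ?s z y x"
    using separation_sym[of _ W] W ne by auto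
  have "\<not> (?s x z y \<and> ?s y z x)" "\<not> (?s y x z \<and> ?s z x y)" "\<not> (?s x y z \<and> ?s z y x)"
    using separation_antisym[OF conn] W ne by metis+
  then show ?thesis
    using forkI[of x W y z] forkI[of y W x z] forkI[of z W x y] W ne sym by metis
qed

text \<open>In \<open>?K\<close> the vertex \<open>x\<close> is a leaf at \<open>a\<close>, and
  \<open>{a, u}\<close> is the only edge between \<open>A\<close> and the rest of
  \<open>V - {x}\<close>. So \<open>x\<close> is matched with \<open>a\<close>, and
  \<open>A - {a}\<close> is matched within itself.\<close>

lemma odd_side:
  assumes rob: "robustly_matchable V E" and x: "x \<in> V" and A: "A \<subseteq> V - {x}" "a \<in> A"
    and conn: "cut_connected A E" "cut_connected (V - {x} - A) E"
    and edges: "(x, a) \<in> E" "u \<in> V - {x} - A" "(u, a) \<in> E"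
  shows "odd (card A)"
proof -
  let ?B = "V - {x} - A"
  let ?K = "E \<inter> A \<times> A \<union> E \<inter> ?B \<times> ?B \<union> {(a, u), (u, a), (x, a), (a, x)}"
  have sym: "sym ?K" using sym_E by (auto simp: sym_def)
  have "cut_connected A ?K" by (rule cut_connected_mono[OF conn(1)]) blast
  moreover have "cut_connected ?B ?K" by (rule cut_connected_mono[OF conn(2)]) blast
  ultimately have "cut_connected (A \<union> ?B) ?K"
    by (rule cut_connected_Un[OF _ _ sym A(2) edges(2)]) blast
  moreover have "cut_connected {x} ?K" unfolding cut_connected_def by blast
  ultimately have "cut_connected (A \<union> ?B \<union> {x}) ?K"
    by (rule cut_connected_Un[OF _ _ sym, where x = a and y = x]) (use A in auto)
  moreover have "A \<union> ?B \<union> {x} = V" using x A(1) by blast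
  ultimately have "cut_connected V ?K" by simp
  moreover have sub: "?K \<subseteq> E" using edges E_sym by blast
  ultimately obtain f where f: "involutive_matching V ?K f"
    using robustly_matchableD[OF rob _ sym] by metis
  then have "(x, f x) \<in> ?K" "f (f x) = x" using x unfolding involutive_matching_def by auto
  moreover have "x \<notin> A" using A by blast
  ultimately have fx: "f x = a" "f a = x" using A(2) edges(2) by auto
  have "even (card (A - {a}))"
  proof (rule even_card_involution[of _ f])
    fix z assume z: "z \<in> A - {a}"
    then have "z \<in> V" using A by blast
    then have fz: "f z \<noteq> z" "(z, f z) \<in> ?K" "f (f z) = z"
      using f unfolding involutive_matching_def by auto
    have "f z \<noteq> a" using fz(3) fx(2) z \<open>x \<notin> A\<close> by auto
    moreover have "f z \<in> A" using fz(2) z edges(2) \<open>x \<notin> A\<close> by auto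
    ultimately show "f z \<in> A - {a} \<and> f z \<noteq> z \<and> f (f z) = z" using fz by blast
  qed (use finite_V A in \<open>auto intro: finite_subset\<close>)
  moreover have "card A = Suc (card (A - {a}))"
    using A finite_V by (intro card.remove) (auto intro: finite_subset)
  ultimately show ?thesis by simp
qed

text \<open>The graph without \<open>x\<close> is split into connected parts \<open>R\<close>,
  \<open>A\<close>, \<open>B\<close> containing \<open>r\<close>, \<open>a\<close>,
  \<open>b\<close>, with \<open>A\<close> and \<open>B\<close> both joined to \<open>R\<close>. By
  \<open>odd_side\<close> both \<open>A\<close> and \<open>B\<close> are odd; once the three parts
  hang on \<open>x\<close> by one edge each, \<open>x\<close> would have to be matched with
  \<open>a\<close> and with \<open>b\<close>.\<close>

lemma no_fork_at_neighbours:
  assumes rob: "robustly_matchable V E" and x: "x \<in> V" and conn: "cut_connected (V - {x}) E"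
    and nb: "(x, r) \<in> E" "(x, a) \<in> E" "(x, b) \<in> E" "r \<noteq> a" "r \<noteq> b" "a \<noteq> b"
  shows "\<not> fork (V - {x}) r a b"
proof
  assume fork: "fork (V - {x}) r a b"
  let ?W = "V - {x}"
  have W: "r \<in> ?W" "a \<in> ?W" "b \<in> ?W" using nb E_V E_irrefl by blast+
  define R where "R = reach E (?W - {a, b}) r"
  define A where "A = reach E (?W - R - {b}) a"
  \<comment> \<open>\<open>B\<close> takes whatever remains; it is connected because every walk from
    \<open>R\<close> or \<open>A\<close> into it enters at \<open>b\<close>.\<close>
  define B where "B = ?W - R - A"
  have R: "R \<subseteq> ?W - {a, b}" unfolding R_def by (rule reach_subset) (use W nb in auto)
  have A: "A \<subseteq> ?W - R - {b}" unfolding A_def by (rule reach_subset) (use W nb R in auto)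
  have mem: "r \<in> R" "a \<in> A" "b \<in> B"
    using reach_root[of r] reach_root[of a] W R A by (auto simp: R_def A_def B_def)
  have R_exit: "z \<in> R \<or> z = a \<or> z = b" if "y \<in> R" "z \<in> ?W" "(y, z) \<in> E" for y z
    using reach_step[of y E "?W - {a, b}" r z] that W nb unfolding R_def by blast
  have A_exit: "z \<in> R \<or> z \<in> A \<or> z = b" if "y \<in> A" "z \<in> ?W" "(y, z) \<in> E" for y z
    using reach_step[of y E "?W - R - {b}" a z] that W nb R unfolding A_def by blast
  have connR: "cut_connected R E"
    unfolding R_def by (rule reach_connected[OF sym_E]) (use W nb in auto)
  have connA: "cut_connected A E"
    unfolding A_def by (rule reach_connected[OF sym_E]) (use W nb R in auto)
  have connB: "cut_connected B E"
  proof (rule cut_connected_rootI[OF sym_E mem(3)])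
    fix S assume S: "S \<subseteq> B" "b \<in> S" "\<And>y z. y \<in> S \<Longrightarrow> z \<in> B \<Longrightarrow> (y, z) \<in> E \<Longrightarrow> z \<in> S"
    have "S \<union> R \<union> A = ?W"
    proof (rule cut_connectedD[OF conn, of _ r])
      show "S \<union> R \<union> A \<subseteq> ?W" using S(1) R A unfolding B_def by blast
      show "r \<in> S \<union> R \<union> A" using mem by blast
      fix y z assume yz: "y \<in> S \<union> R \<union> A" "z \<in> ?W" "(y, z) \<in> E"
      show "z \<in> S \<union> R \<union> A"
      proof (cases "y \<in> S")
        case True
        then show ?thesis using S(3)[of y z] yz unfolding B_def by blast
      next
        case False
        then show ?thesis using R_exit[of y z] A_exit[of y z] yz S(2) mem by blast
      qed
    qed
    then show "S = B" using S(1) unfolding B_def by blast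
  qed
  obtain u v where u: "u \<in> R" "(u, a) \<in> E" and v: "v \<in> R" "(v, b) \<in> E"
    using fork unfolding fork_def R_def by blast
  have dec: "?W - A = R \<union> B" "?W - B = R \<union> A" using R A unfolding B_def by blast+
  have "cut_connected (R \<union> B) E"
    by (rule cut_connected_Un[OF connR connB sym_E v(1) mem(3)]) (use v in blast)
  then have oddA: "odd (card A)"
    using odd_side[OF rob x _ mem(2) connA _ nb(2) _ u(2)] u(1) A unfolding dec by blast
  have "cut_connected (R \<union> A) E"
    by (rule cut_connected_Un[OF connR connA sym_E u(1) mem(2)]) (use u in blast)
  moreover have "B \<subseteq> ?W" unfolding B_def by blast
  ultimately have oddB: "odd (card B)"
    using odd_side[OF rob x _ mem(3) connB _ nb(3) _ v(2)] v(1) unfolding dec by blast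
  \<comment> \<open>Now \<open>R\<close>, \<open>A\<close> and \<open>B\<close> are joined only
    through \<open>x\<close>.\<close>
  let ?K = "E \<inter> A \<times> A \<union> E \<inter> B \<times> B \<union> E \<inter> R \<times> R
    \<union> {(x, a), (a, x), (x, b), (b, x), (x, r), (r, x)}"
  have sym: "sym ?K" using sym_E by (auto simp: sym_def)
  have c: "cut_connected A ?K" "cut_connected B ?K" "cut_connected R ?K" "cut_connected {x} ?K"
    using cut_connected_mono[OF connA, of ?K] cut_connected_mono[OF connB, of ?K]
      cut_connected_mono[OF connR, of ?K]
    by (auto simp: cut_connected_def[of "{x}"])
  have "cut_connected ({x} \<union> A) ?K"
    by (rule cut_connected_Un[OF c(4,1) sym _ mem(2), of x]) auto
  then have "cut_connected ({x} \<union> A \<union> B) ?K"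
    by (rule cut_connected_Un[OF _ c(2) sym _ mem(3), of _ x]) auto
  then have "cut_connected ({x} \<union> A \<union> B \<union> R) ?K"
    by (rule cut_connected_Un[OF _ c(3) sym _ mem(1), of _ x]) auto
  moreover have "{x} \<union> A \<union> B \<union> R = V" using x R A unfolding B_def by blast
  ultimately have "cut_connected V ?K" by simp
  moreover have "?K \<subseteq> E" using nb E_sym by blast
  ultimately obtain f where f: "involutive_matching V ?K f"
    using robustly_matchableD[OF rob _ sym] by metis
  have "A \<subseteq> V" "B \<subseteq> V" using A unfolding B_def by blast+
  have disj: "A \<inter> B = {}" "A \<inter> R = {}" "B \<inter> R = {}" "x \<notin> A" "x \<notin> B"
    using A R unfolding B_def by blast+
  obtain a' where a': "a' \<in> A" "f a' \<in> V - A" "(a', f a') \<in> ?K" "f (f a') = a'"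
    using odd_matched_outside[OF f finite_V \<open>A \<subseteq> V\<close> oddA] .
  \<comment> \<open>The only arc of \<open>?K\<close> leaving \<open>A\<close> is
    \<open>(a, x)\<close>.\<close>
  have "f x = a" using a' mem disj by auto
  obtain b' where b': "b' \<in> B" "f b' \<in> V - B" "(b', f b') \<in> ?K" "f (f b') = b'"
    using odd_matched_outside[OF f finite_V \<open>B \<subseteq> V\<close> oddB] .
  have "f x = b" using b' mem disj by auto
  then show False using \<open>f x = a\<close> nb by blast
qed

text \<open>Three distinct neighbours would, by \<open>fork_exists\<close> in the connected graph on
  \<open>V - {x}\<close>, form a fork in some order.\<close>

lemma at_most_two_neighbours:
  assumes "robustly_matchable V E" "cut_connected (V - {x}) E"
    and nb: "(x, a) \<in> E" "(x, b) \<in> E" "(x, d) \<in> E"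
  shows "a = b \<or> a = d \<or> b = d"
proof (rule ccontr)
  assume ne: "\<not> ?thesis"
  have "x \<in> V" "a \<in> V - {x}" "b \<in> V - {x}" "d \<in> V - {x}" using nb E_V E_irrefl by blast+
  then show False
    using fork_exists[OF assms(2), of a b d] no_fork_at_neighbours[OF assms(1) _ assms(2)] nb ne
    by metis
qed

section \<open>Degree two and cycles\<close>

lemma two_neighbours:
  assumes conn: "cut_connected V E" and nocut: "\<And>y. y \<in> V \<Longrightarrow> cut_connected (V - {y}) E"
    and x: "x \<in> V" and card: "2 < card V"
  obtains y z where "(x, y) \<in> E" "(x, z) \<in> E" "y \<noteq> z"
proof -
  have "V \<noteq> {x}" using card by auto
  then obtain y where y: "(x, y) \<in> E"
    using cut_connected_outgoing[OF conn, of "{x}"] x by blast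
  then have "y \<in> V" "y \<noteq> x" using E_V E_irrefl by blast+
  have "V - {y} \<noteq> {x}"
  proof
    assume "V - {y} = {x}"
    then have "V = {x, y}" using \<open>y \<in> V\<close> by blast
    then show False using card \<open>y \<noteq> x\<close> by simp
  qed
  \<comment> \<open>The vertex \<open>y\<close> is not a cut vertex, so \<open>x\<close> still has a
    neighbour once \<open>y\<close> is deleted.\<close>
  then obtain z where "(x, z) \<in> E" "z \<in> V - {y}"
    using cut_connected_outgoing[OF nocut[OF \<open>y \<in> V\<close>], of "{x}"] x \<open>y \<noteq> x\<close> by blast
  then show ?thesis using that y by blast
qed

text \<open>A longest path closes up: the second neighbour of its last vertex lies on the path by
  maximality and cannot be an inner vertex, as that vertex would have three neighbours. The
  resulting cycle contains all neighbours of its vertices, hence by connectedness all of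
  \<open>V\<close>.\<close>

lemma two_regular_cycle:
  assumes conn: "cut_connected V E"
    and two: "\<And>x. x \<in> V \<Longrightarrow> \<exists>y z. (x, y) \<in> E \<and> (x, z) \<in> E \<and> y \<noteq> z"
    and three: "\<And>x a b d. (x, a) \<in> E \<Longrightarrow> (x, b) \<in> E \<Longrightarrow> (x, d) \<in> E \<Longrightarrow> a = b \<or> a = d \<or> b = d"
  obtains xs where "distinct xs" "3 \<le> length xs" "set xs = V" "parcs (cycle_graph xs) = E"
proof -
  define path where "path xs \<longleftrightarrow> distinct xs \<and> set xs \<subseteq> V \<and>
    (\<forall>i. Suc i < length xs \<longrightarrow> (xs ! i, xs ! Suc i) \<in> E)" for xs
  obtain x0 where "x0 \<in> V" using conn unfolding cut_connected_def by blast
  then obtain y0 z0 where nb0: "(x0, y0) \<in> E" "(x0, z0) \<in> E" "y0 \<noteq> z0" using two by blast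
  \<comment> \<open>This path guarantees that a longest path has at least three vertices.\<close>
  have "path [y0, x0, z0]"
    unfolding path_def
  proof (intro conjI allI impI)
    show "distinct [y0, x0, z0]" using nb0 E_irrefl by auto
    show "set [y0, x0, z0] \<subseteq> V" using nb0 E_V by auto
    fix i assume "Suc i < length [y0, x0, z0]"
    then consider "i = 0" | "i = 1" by fastforce
    then show "([y0, x0, z0] ! i, [y0, x0, z0] ! Suc i) \<in> E"
      using nb0 E_sym[OF nb0(1)] by cases simp_all
  qed
  moreover have "length xs < Suc (card V)" if "path xs" for xs
    using that card_mono[OF finite_V, of "set xs"] distinct_card[of xs]
    unfolding path_def by (simp add: less_Suc_eq_le)
  ultimately obtain xs where xs: "path xs"
    and max: "\<And>ys. path ys \<Longrightarrow> length ys \<le> length xs"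
    using Lattices_Big.ex_has_greatest_nat[of path "[y0, x0, z0]" length "Suc (card V)"] by blast
  define n where "n = length xs"
  have n: "3 \<le> n" using max[OF \<open>path [y0, x0, z0]\<close>] by (simp add: n_def)
  have dist: "distinct xs" and sub: "set xs \<subseteq> V"
    and step: "\<And>i. Suc i < n \<Longrightarrow> (xs ! i, xs ! Suc i) \<in> E"
    using xs unfolding path_def n_def by auto
  have neq: "xs ! i \<noteq> xs ! j" if "i < n" "j < n" "i \<noteq> j" for i j
    using that dist by (simp add: n_def nth_eq_iff_index_eq)
  let ?l = "xs ! (n - 1)"
  have "?l \<in> V" using sub n unfolding n_def by auto
  then obtain z where z: "(?l, z) \<in> E" "z \<noteq> xs ! (n - 2)" using two by metis
  have "z \<in> set xs"
  proof (rule ccontr)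
    assume out: "z \<notin> set xs"
    have "path (xs @ [z])"
      unfolding path_def
    proof (intro conjI allI impI)
      fix i assume i: "Suc i < length (xs @ [z])"
      show "((xs @ [z]) ! i, (xs @ [z]) ! Suc i) \<in> E"
      proof (cases "Suc i < n")
        case True
        then show ?thesis using step[of i] by (simp add: nth_append n_def)
      next
        case False
        then have "i = n - 1" "Suc i = n" using i by (auto simp: n_def)
        then show ?thesis using z n by (auto simp: nth_append n_def)
      qed
    qed (use dist sub out z E_V in auto)
    then show False using max by fastforce
  qed
  then obtain j where j: "j < n" "z = xs ! j" unfolding n_def by (metis in_set_conv_nth)
  have "j \<noteq> n - 1" "j \<noteq> n - 2" using z j E_irrefl by auto
  \<comment> \<open>Otherwise \<open>xs ! j\<close> would have neighbours at the positions
    \<open>j - 1\<close>, \<open>j + 1\<close> and \<open>n - 1\<close>, which are distinct because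
    \<open>j < n - 2\<close>.\<close>
  have "j = 0"
  proof (rule ccontr)
    assume "j \<noteq> 0"
    then have "(xs ! j, xs ! (j - 1)) \<in> E" using step[of "j - 1"] j E_sym by simp
    moreover have "(xs ! j, xs ! Suc j) \<in> E" using step[of j] j \<open>j \<noteq> n - 1\<close> by simp
    moreover have "(xs ! j, ?l) \<in> E" using z j E_sym by simp
    ultimately show False
      using three neq[of "j - 1" "Suc j"] neq[of "j - 1" "n - 1"] neq[of "Suc j" "n - 1"]
        j n \<open>j \<noteq> n - 1\<close> \<open>j \<noteq> n - 2\<close> by fastforce
  qed
  have cyc: "(xs ! i, xs ! (Suc i mod n)) \<in> E" if "i < n" for i
  proof (cases "Suc i = n")
    case True
    then have "i = n - 1" by simp
    then show ?thesis using z j \<open>j = 0\<close> True by simp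
  qed (use step[of i] that in simp)
  have nb: "\<exists>k<n. {xs ! i, v} = {xs ! k, xs ! (Suc k mod n)}" if "i < n" "(xs ! i, v) \<in> E" for i v
  proof -
    \<comment> \<open>\<open>p\<close> is the cyclic predecessor of \<open>i\<close>, namely
      \<open>n - 1\<close> for \<open>i = 0\<close>; it differs from the cyclic successor because
      \<open>n \<ge> 3\<close>.\<close>
    obtain p where p: "p < n" "Suc p mod n = i" "p \<noteq> Suc i mod n"
    proof (cases i)
      case 0
      then show ?thesis using that[of "n - 1"] n by auto
    next
      case (Suc k)
      then have "k \<noteq> Suc i mod n"
        using \<open>i < n\<close> n by (cases "Suc i = n") auto
      then show ?thesis using that[of k] Suc \<open>i < n\<close> by auto
    qed
    have "(xs ! i, xs ! p) \<in> E" using cyc[OF p(1)] p(2) E_sym by simp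
    moreover have "(xs ! i, xs ! (Suc i mod n)) \<in> E" using cyc that by blast
    moreover have "xs ! p \<noteq> xs ! (Suc i mod n)" using neq p n by simp
    ultimately have "v = xs ! p \<or> v = xs ! (Suc i mod n)" using three that(2) by blast
    then show ?thesis using p that(1) by (auto simp: insert_commute)
  qed
  have "set xs = V"
  proof (rule cut_connectedD[OF conn sub \<open>z \<in> set xs\<close>])
    fix a b assume "a \<in> set xs" "(a, b) \<in> E"
    then obtain i where "i < n" "a = xs ! i" unfolding n_def by (metis in_set_conv_nth)
    then obtain k where "k < n" "{a, b} = {xs ! k, xs ! (Suc k mod n)}" using nb \<open>(a, b) \<in> E\<close> by blast
    moreover have "Suc k mod n < n" using n by simp
    ultimately show "b \<in> set xs" unfolding n_def by (metis doubleton_eq_iff nth_mem)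
  qed
  moreover have "parcs (cycle_graph xs) = E"
  proof (intro set_eqI iffI)
    fix e assume e: "e \<in> E"
    obtain a b where ab: "e = (a, b)" by (cases e)
    then have "a \<in> set xs" using e E_V \<open>set xs = V\<close> by blast
    then obtain i where "i < n" "a = xs ! i" unfolding n_def by (metis in_set_conv_nth)
    then show "e \<in> parcs (cycle_graph xs)"
      using nb[of i b] e unfolding ab parcs_cycle_graph_iff n_def by blast
  next
    fix e assume e: "e \<in> parcs (cycle_graph xs)"
    obtain a b where ab: "e = (a, b)" by (cases e)
    then obtain k where "k < n" "{a, b} = {xs ! k, xs ! (Suc k mod n)}"
      using e unfolding ab parcs_cycle_graph_iff n_def by blast
    then show "e \<in> E" using cyc[of k] E_sym unfolding ab doubleton_eq_iff by auto
  qed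
  ultimately show ?thesis using that dist n unfolding n_def by blast
qed

end

section \<open>Robustly matchable graphs belong to the family\<close>

lemma robustly_matchable_family_G:
  assumes "ugraph V E" "cut_connected V E" "robustly_matchable V E"
  shows "\<lparr>pverts = V, parcs = E\<rparr> \<in> family_G"
  using assms
proof (induction "card V" arbitrary: V E rule: less_induct)
  case less
  interpret ugraph V E by fact
  note conn = less.prems(2) and rob = less.prems(3)
  \<comment> \<open>The whole graph is a connected spanning subgraph of itself, so it has a perfect
    matching.\<close>
  have even: "even (card V)"
    using conn rob sym_E finite_V matchable_even unfolding robustly_matchable_def by blast
  have "V \<noteq> {}" using conn unfolding cut_connected_def by blast
  then have "card V \<noteq> 0" using finite_V by simp
  \<comment> \<open>Evenness excludes a single vertex.\<close>
  then consider "card V = 2" | "2 < card V" "\<forall>c\<in>V. cut_connected (V - {c}) E"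
    | c where "2 < card V" "c \<in> V" "\<not> cut_connected (V - {c}) E"
    using even by (metis One_nat_def less_2_cases linorder_neqE_nat odd_one)
  then show ?case
  proof cases
    case 1
    then obtain u v where V: "V = {u, v}" "u \<noteq> v" by (auto simp: card_2_iff)
    obtain y where "(u, y) \<in> E" "y \<in> V - {u}"
      using cut_connected_outgoing[OF conn, of "{u}"] V by blast
    then have "(u, v) \<in> E" "(v, u) \<in> E" using V E_sym by auto
    then have E: "E = {(a, b). (a, b) \<in> V \<times> V \<and> a \<noteq> b}"
      using E_subset E_irrefl V by auto
    have "pair_graph \<lparr>pverts = V, parcs = E\<rparr>"
      using finite_V E_subset sym_E irrefl_E by (simp add: pair_graph_iff)
    then have "complete_digraph 2 (with_proj \<lparr>pverts = V, parcs = E\<rparr>)"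
      unfolding complete_digraph_def using pair_graph.pair_graphD_graph 1 E by force
    then show ?thesis by (rule family_G.K2)
  next
    case 2
    obtain xs where xs: "distinct xs" "3 \<le> length xs" "set xs = V" "parcs (cycle_graph xs) = E"
    proof (rule two_regular_cycle[OF conn])
      fix x assume "x \<in> V"
      then show "\<exists>y z. (x, y) \<in> E \<and> (x, z) \<in> E \<and> y \<noteq> z"
        using two_neighbours[OF conn] 2 by metis
    next
      fix x a b d assume nb: "(x, a) \<in> E" "(x, b) \<in> E" "(x, d) \<in> E"
      then have "cut_connected (V - {x}) E" using 2 E_V by blast
      then show "a = b \<or> a = d \<or> b = d" using at_most_two_neighbours[OF rob] nb by blast
    qed
    have "even (length xs)" using even xs distinct_card by metis
    moreover have "cycle_graph xs = \<lparr>pverts = V, parcs = E\<rparr>"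
      using xs by (intro pair_pre_digraph.equality) auto
    ultimately show ?thesis using family_G.even_cycle[OF xs(1,2)] by simp
  next
    case 3
    then have "V \<noteq> {c}" by auto
    then obtain U where U: "U \<subseteq> V - {c}" "U \<noteq> {}" "even (card U)"
      "\<And>a b. a \<in> U \<Longrightarrow> (a, b) \<in> E \<Longrightarrow> b \<in> insert c U"
      using even_part_at_cut_vertex[OF conn even] 3 by metis
    interpret cut_part V E c U by unfold_locales (use conn 3 U in auto)
    \<comment> \<open>Each root keeps its name, so the attachment map is the identity and the
      composed graph is literally the given one.\<close>
    let ?H = "\<lparr>pverts = roots, parcs = E \<inter> roots \<times> roots\<rparr>"
    let ?F = "\<lambda>w. \<lparr>pverts = branch w, parcs = E \<inter> branch w \<times> branch w\<rparr>"
    have "roots \<subseteq> V" using roots_subset U_subset c_V by blast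
    then have H: "pair_graph ?H"
      using finite_V irrefl_E sym_Restr by (auto simp: pair_graph_iff irrefl_def intro: finite_subset)
    have "cut_connected roots (E \<inter> roots \<times> roots)"
      by (rule cut_connected_mono[OF cut_connected_roots]) blast
    then have "Digraph_Component.connected (with_proj ?H)"
      using connected_iff_cut_connected[of ?H] sym_Restr by auto
    moreover have "?F w \<in> family_G" if w: "w \<in> roots" for w
    proof (rule less.hyps)
      have w': "w \<in> insert c U" using w roots_subset by blast
      show "card (branch w) < card V" using card_branch_less w .
      show "ugraph (branch w) (E \<inter> branch w \<times> branch w)" by (rule ugraph_Restr[OF branch_subset_V])
      show "cut_connected (branch w) (E \<inter> branch w \<times> branch w)"
        by (rule cut_connected_mono[OF cut_connected_branch[OF w']]) blast
      show "robustly_matchable (branch w) (E \<inter> branch w \<times> branch w)"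
        using robustly_matchable_part[OF conn rob branch_subset_V root_in_own_branch[OF w]
            branches_even[OF rob even U(3) w] branch_exit[OF w']] .
    qed
    ultimately have "identify_graph ?H ?F (\<lambda>w. w) \<in> family_G"
      using H card_roots branches_disjoint root_in_own_branch by (intro family_G.identify) auto
    moreover have "identify_graph ?H ?F (\<lambda>w. w) = \<lparr>pverts = V, parcs = E\<rparr>"
      using branches_cover edges_decomposition unfolding identify_graph_def by auto
    ultimately show ?thesis by simp
  qed
qed

theorem theorem1p1:
  fixes G :: "'a pair_pre_digraph"
  assumes "pair_graph G" and "Digraph_Component.connected G"
  shows "((\<nexists>S. anti_kekule_set G S) \<longleftrightarrow>
            (\<forall>H. connected_spanning_subgraph H G \<longrightarrow> has_perfect_matching H))
       \<and> ((\<forall>H. connected_spanning_subgraph H G \<longrightarrow> has_perfect_matching H) \<longleftrightarrow>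
            (\<forall>T. undirected_spanning_tree T G \<longrightarrow> has_perfect_matching T))
       \<and> ((\<forall>T. undirected_spanning_tree T G \<longrightarrow> has_perfect_matching T) \<longleftrightarrow>
            G \<in> family_G)"
proof -
  have G: "ugraph (pverts G) (parcs G)"
    using assms(1) unfolding pair_graph_iff by unfold_locales auto
  have eta: "\<lparr>pverts = pverts G, parcs = parcs G\<rparr> = G"
    by (rule pair_pre_digraph.equality) simp_all
  have "cut_connected (pverts G) (parcs G)"
    using assms connected_iff_cut_connected[of G] by (auto simp: pair_graph_iff)
  then have "robustly_matchable (pverts G) (parcs G) \<longleftrightarrow> G \<in> family_G"
    using robustly_matchable_family_G[OF G] family_G_robustly_matchable[of G] eta by metis
  then show ?thesis
    using no_anti_kekule_set_iff all_spanning_trees_iff all_connected_spanning_subgraphs_iff assms(1)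
    by metis
qed

end
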